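(* The functor $\nu\colon\mathcal{C}_{\mathrm{da}}\to\infty\text{-}\mathrm{Cat}$ is fully faithful when restricted to the full subcategory of $\mathcal{C}_{\mathrm{da}}$ spanned by strong Steiner complexes and their truncations $\tau_{\le n}(K)$ (for $K$ a strong Steiner complex and $n\ge0$).
   Context: An augmented directed complex is a triple $(K,K^*,e)$ where $K$ is a chain complex of abelian groups in non-negative degrees (with differentials $d_i\colon K_i\to K_{i-1}$), $e\colon K_0\to\mathbb{Z}$ satisfies $e d_1=0$, and $K^*=(K^*_i)_{i\ge0}$ with $K_i^*$ a submonoid of $K_i$. Morphisms $(K,K^*,e)\to(K',K'^*,e')$ are chain maps $f$ with $f_i(K_i^* )\subseteq K_i'^*$ and $e'f_0=e$. The resulting category is $\mathcal{C}_{\mathrm{da}}$. $\infty\text{-}\mathrm{Cat}$ is the category of small strict $\infty$-categories and strict $\infty$-functors. A basis of $K$ is a graded set $B=(B_i)_{i\ge0}$ such that $B_i$ is a basis of the $\mathbb{Z}$-module $K_i$ and generates the monoid $K_i^*$. If $K$ has a basis, the support $\mathrm{supp}(x)$ of an $i$-chain $x\in K_i$ is the set of basis elements with non-zero coefficient in $x$, and $x=x_+-x_-$ uniquely with $x_+,x_-\in K_i^*$ of disjoint supports. For $x\in B_i$ define $\langle x\rangle^0_i=x=\langle x\rangle^1_i$ and, for $0<k\le i$, $\langle x\rangle^0_{k-1}=d(\langle x\rangle^0_k)_-$ and $\langle x\rangle^1_{k-1}=d(\langle x\rangle^1_k)_+$. The basis is unital if $e(\langle x\rangle^0_0)=1=e(\langle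 x\rangle^1_0)$ for all $i\ge0$ and $x\in B_i$. Let $\le_{\mathbb{N}}$ be the smallest preorder on $\coprod_iB_i$ with $x\le_{\mathbb{N}}y$ whenever $x\in\mathrm{supp}(d(y)_-)$ or $y\in\mathrm{supp}(d(x)_+)$ (with the convention $d(b)=0$ for $b\in B_0$). The basis is strongly loop-free if $\le_{\mathbb{N}}$ is a partial order. A strong Steiner complex is an augmented directed complex with a unital and strongly loop-free basis. For $n\ge0$ the truncation $\tau_{\le n}(K)$ is the augmented directed complex with $\tau_{\le n}(K)_i$ equal to $K_i$ for $i<n$, $K_n/d(K_{n+1})$ for $i=n$, and $0$ for $i>n$; $\tau_{\le n}(K)^*_i$ equal to $K^*_i$ for $i<n$, the image of $K_n^*$ in $K_n/d(K_{n+1})$ for $i=n$, and $0$ for $i>n$; differentials and augmentation are inherited. The functor $\nu$: the $i$-cells of $\nu(K)$ are the matrices $\begin{pmatrix}x^0_0&\dots&x^0_i\\ x^1_0&\dots&x^1_i\end{pmatrix}$ with $x^\epsilon_k\in K^*_k$; $d(x^\epsilon_k)=x^1_{k-1}-x^0_{k-1}$ for $0<k\le i$; $e(x^\epsilon_0)=1$; and $x^0_i=x^1_i$ (with $\epsilon=0,1$ throughout). The $j$-source (resp. $j$-target) is obtained by deleting the columns of index $>j$ and replacing both entries of column $j$ by $x^0_j$ (resp. $x^1_j$); identities append a zero column; if the $j$-source of $x$ equals the $j$-target of $y$, then $x\ast_j y$ has entries $x^\epsilon_k=y^\epsilon_k$ for $k<j$, column $j$ equal to $(y^0_j,x^1_j)$,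 and entries $x^\epsilon_k+y^\epsilon_k$ for $k>j$. Morphisms act entrywise. *)

theory Defs
  imports "HOL-Algebra.Free_Abelian_Groups" "HOL.Hull"
begin

section \<open>Augmented directed complexes\<close>

text \<open>
  Abelian groups are HOL-Algebra groups, written multiplicatively: the sum of two chains is
  \<open>x \<otimes> y\<close>, the zero chain is \<open>\<one>\<close> and the difference is \<open>x \<otimes> inv y\<close>. The differential
  \<open>diff K i\<close> goes from degree \<open>i\<close> to degree \<open>i - 1\<close>; its value at \<open>i = 0\<close> is never used.
\<close>

record 'a adc_data =
  chain :: "nat \<Rightarrow> 'a monoid"
  pos :: "nat \<Rightarrow> 'a set"
  diff :: "nat \<Rightarrow> 'a \<Rightarrow> 'a"
  aug :: "'a \<Rightarrow> int"

locale adc =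
  fixes K :: "'a adc_data"
  assumes comm_group_chain: "comm_group (chain K i)"
    and submonoid_pos: "submonoid (pos K i) (chain K i)"
    and diff_hom: "diff K (Suc i) \<in> hom (chain K (Suc i)) (chain K i)"
    and diff_diff: "x \<in> carrier (chain K (Suc (Suc i))) \<Longrightarrow>
      diff K (Suc i) (diff K (Suc (Suc i)) x) = \<one>\<^bsub>chain K i\<^esub>"
    and aug_hom: "aug K \<in> hom (chain K 0) integer_group"
    and aug_diff: "x \<in> carrier (chain K 1) \<Longrightarrow> aug K (diff K 1 x) = 0"

text \<open>Morphisms are extensional outside the carriers, so that equality of morphisms is
  equality of functions.\<close>

locale adc_morphism = source: adc K + target: adc L
  for K :: "'a adc_data" and L :: "'b adc_data" +
  fixes f :: "nat \<Rightarrow> 'a \<Rightarrow> 'b"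
  assumes map_extensional: "f i \<in> extensional (carrier (chain K i))"
    and map_hom: "f i \<in> hom (chain K i) (chain L i)"
    and map_diff: "x \<in> carrier (chain K (Suc i)) \<Longrightarrow>
      f i (diff K (Suc i) x) = diff L (Suc i) (f (Suc i) x)"
    and map_pos: "f i ` pos K i \<subseteq> pos L i"
    and map_aug: "x \<in> carrier (chain K 0) \<Longrightarrow> aug L (f 0 x) = aug K x"

definition adc_hom :: "'a adc_data \<Rightarrow> 'b adc_data \<Rightarrow> (nat \<Rightarrow> 'a \<Rightarrow> 'b) set" where
  "adc_hom K L = {f. adc_morphism K L f}"

definition adc_id :: "'a adc_data \<Rightarrow> nat \<Rightarrow> 'a \<Rightarrow> 'a" where
  "adc_id K i = (\<lambda>x\<in>carrier (chain K i). x)"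

definition adc_compose ::
  "'a adc_data \<Rightarrow> (nat \<Rightarrow> 'b \<Rightarrow> 'c) \<Rightarrow> (nat \<Rightarrow> 'a \<Rightarrow> 'b) \<Rightarrow> nat \<Rightarrow> 'a \<Rightarrow> 'c" where
  "adc_compose K g f i = compose (carrier (chain K i)) (g i) (f i)"


section \<open>Strong Steiner complexes\<close>

definition lincomb :: "('a, 'm) monoid_scheme \<Rightarrow> ('a \<Rightarrow>\<^sub>0 int) \<Rightarrow> 'a" where
  "lincomb G c = finprod G (\<lambda>b. b [^]\<^bsub>G\<^esub> Poly_Mapping.lookup c b) (Poly_Mapping.keys c)"

definition int_basis :: "('a, 'm) monoid_scheme \<Rightarrow> 'a set \<Rightarrow> bool" where
  "int_basis G B \<longleftrightarrow> B \<subseteq> carrier G \<and>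
    (\<forall>x\<in>carrier G. \<exists>!c. Poly_Mapping.keys c \<subseteq> B \<and> x = lincomb G c)"

definition coeffs :: "('a, 'm) monoid_scheme \<Rightarrow> 'a set \<Rightarrow> 'a \<Rightarrow> 'a \<Rightarrow>\<^sub>0 int" where
  "coeffs G B x = (THE c. Poly_Mapping.keys c \<subseteq> B \<and> x = lincomb G c)"

definition supp :: "('a, 'm) monoid_scheme \<Rightarrow> 'a set \<Rightarrow> 'a \<Rightarrow> 'a set" where
  "supp G B x = Poly_Mapping.keys (coeffs G B x)"

definition adc_basis :: "'a adc_data \<Rightarrow> (nat \<Rightarrow> 'a set) \<Rightarrow> bool" where
  "adc_basis K B \<longleftrightarrow> (\<forall>i. int_basis (chain K i) (B i) \<and>
    pos K i = (\<lambda>M. submonoid M (chain K i)) hull B i)"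

definition is_decomposition ::
  "'a adc_data \<Rightarrow> (nat \<Rightarrow> 'a set) \<Rightarrow> nat \<Rightarrow> 'a \<Rightarrow> 'a \<Rightarrow> 'a \<Rightarrow> bool" where
  "is_decomposition K B i x p m \<longleftrightarrow> p \<in> pos K i \<and> m \<in> pos K i \<and>
    x = p \<otimes>\<^bsub>chain K i\<^esub> inv\<^bsub>chain K i\<^esub> m \<and>
    supp (chain K i) (B i) p \<inter> supp (chain K i) (B i) m = {}"

definition pos_part :: "'a adc_data \<Rightarrow> (nat \<Rightarrow> 'a set) \<Rightarrow> nat \<Rightarrow> 'a \<Rightarrow> 'a" where
  "pos_part K B i x = (THE p. \<exists>m. is_decomposition K B i x p m)"

definition neg_part :: "'a adc_data \<Rightarrow> (nat \<Rightarrow> 'a set) \<Rightarrow> nat \<Rightarrow> 'a \<Rightarrow> 'a" where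
  "neg_part K B i x = (THE m. \<exists>p. is_decomposition K B i x p m)"

text \<open>
  Superscripts \<open>\<epsilon> \<in> {0, 1}\<close> are encoded as booleans, \<open>False\<close> being 0. For \<open>x\<close> in \<open>B i\<close> and
  \<open>k \<le> i\<close>, \<open>atom K B i x \<epsilon> k\<close> is the chain \<open>\<langle>x\<rangle>\<^sup>\<epsilon>\<^sub>k\<close>; it is reached from
  \<open>x\<close> by \<open>i - k\<close> steps of \<open>atom_desc\<close>.
\<close>

primrec atom_desc ::
  "'a adc_data \<Rightarrow> (nat \<Rightarrow> 'a set) \<Rightarrow> nat \<Rightarrow> 'a \<Rightarrow> bool \<Rightarrow> nat \<Rightarrow> 'a" where
  "atom_desc K B i x \<epsilon> 0 = x"
| "atom_desc K B i x \<epsilon> (Suc r) =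
    (if \<epsilon> then pos_part else neg_part) K B (i - Suc r) (diff K (i - r) (atom_desc K B i x \<epsilon> r))"

definition atom :: "'a adc_data \<Rightarrow> (nat \<Rightarrow> 'a set) \<Rightarrow> nat \<Rightarrow> 'a \<Rightarrow> bool \<Rightarrow> nat \<Rightarrow> 'a" where
  "atom K B i x \<epsilon> k = atom_desc K B i x \<epsilon> (i - k)"

definition unital :: "'a adc_data \<Rightarrow> (nat \<Rightarrow> 'a set) \<Rightarrow> bool" where
  "unital K B \<longleftrightarrow> (\<forall>i. \<forall>x\<in>B i. \<forall>\<epsilon>. aug K (atom K B i x \<epsilon> 0) = 1)"

text \<open>Elements of the disjoint union of the \<open>B i\<close> are pairs \<open>(i, b)\<close>.\<close>

definition leN_step :: "'a adc_data \<Rightarrow> (nat \<Rightarrow> 'a set) \<Rightarrow> ((nat \<times> 'a) \<times> (nat \<times> 'a)) set" where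
  "leN_step K B = {((i, x), (j, y)). x \<in> B i \<and> y \<in> B j \<and>
    (j = Suc i \<and> x \<in> supp (chain K i) (B i) (neg_part K B i (diff K j y)) \<or>
     i = Suc j \<and> y \<in> supp (chain K j) (B j) (pos_part K B j (diff K i x)))}"

definition leN :: "'a adc_data \<Rightarrow> (nat \<Rightarrow> 'a set) \<Rightarrow> ((nat \<times> 'a) \<times> (nat \<times> 'a)) set" where
  "leN K B = Restr ((leN_step K B)\<^sup>*) (Sigma UNIV B)"

definition strongly_loop_free :: "'a adc_data \<Rightarrow> (nat \<Rightarrow> 'a set) \<Rightarrow> bool" where
  "strongly_loop_free K B \<longleftrightarrow> partial_order_on (Sigma UNIV B) (leN K B)"

definition strong_steiner :: "'a adc_data \<Rightarrow> bool" where
  "strong_steiner K \<longleftrightarrow> adc K \<and> (\<exists>B. adc_basis K B \<and> unital K B \<and> strongly_loop_free K B)"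


section \<open>Truncations\<close>

text \<open>
  The truncation in degree \<open>i\<close> is the quotient of the \<open>i\<close>-chains by \<open>trunc_sub K n i\<close>. Since
  all degrees share one type of elements, the groups in degrees \<open>i < n\<close> also consist of
  cosets, namely those of the trivial subgroup; those in degrees \<open>i > n\<close> are quotients of a
  group by itself, hence zero.
\<close>

definition trunc_sub :: "'a adc_data \<Rightarrow> nat \<Rightarrow> nat \<Rightarrow> 'a set" where
  "trunc_sub K n i =
    (if i < n then {\<one>\<^bsub>chain K i\<^esub>}
     else if i = n then diff K (Suc n) ` carrier (chain K (Suc n))
     else carrier (chain K i))"

definition trunc :: "nat \<Rightarrow> 'a adc_data \<Rightarrow> 'a set adc_data" where
  "trunc n K = \<lparr>
    chain = (\<lambda>i. chain K i Mod trunc_sub K n i),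
    pos = (\<lambda>i. (\<lambda>x. trunc_sub K n i #>\<^bsub>chain K i\<^esub> x) ` pos K i),
    diff = (\<lambda>i X. trunc_sub K n (i - 1) <#>\<^bsub>chain K (i - 1)\<^esub> (diff K i ` X)),
    aug = (\<lambda>X. the_elem (aug K ` X))\<rparr>"


section \<open>Strict infinity-categories\<close>

text \<open>
  \<open>src C i j\<close> and \<open>tgt C i j\<close> send an \<open>i\<close>-cell to its \<open>j\<close>-source and \<open>j\<close>-target, for
  \<open>j < i\<close>; \<open>ident C i\<close> sends an \<open>i\<close>-cell to an \<open>(i + 1)\<close>-cell; \<open>comp C i j x y\<close> is \<open>x *\<^sub>j y\<close> for
  \<open>i\<close>-cells \<open>x\<close>, \<open>y\<close> such that the \<open>j\<close>-source of \<open>x\<close> is the \<open>j\<close>-target of \<open>y\<close>.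
\<close>

record 'c inf_cat_data =
  cells :: "nat \<Rightarrow> 'c set"
  src :: "nat \<Rightarrow> nat \<Rightarrow> 'c \<Rightarrow> 'c"
  tgt :: "nat \<Rightarrow> nat \<Rightarrow> 'c \<Rightarrow> 'c"
  ident :: "nat \<Rightarrow> 'c \<Rightarrow> 'c"
  comp :: "nat \<Rightarrow> nat \<Rightarrow> 'c \<Rightarrow> 'c \<Rightarrow> 'c"

primrec iter_ident :: "'c inf_cat_data \<Rightarrow> nat \<Rightarrow> nat \<Rightarrow> 'c \<Rightarrow> 'c" where
  "iter_ident C j 0 x = x"
| "iter_ident C j (Suc r) x = ident C (j + r) (iter_ident C j r x)"

locale inf_cat =
  fixes C :: "'c inf_cat_data"
  assumes src_cell: "j < i \<Longrightarrow> x \<in> cells C i \<Longrightarrow> src C i j x \<in> cells C j"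
    and tgt_cell: "j < i \<Longrightarrow> x \<in> cells C i \<Longrightarrow> tgt C i j x \<in> cells C j"
    and ident_cell: "x \<in> cells C i \<Longrightarrow> ident C i x \<in> cells C (Suc i)"
    and comp_cell: "j < i \<Longrightarrow> x \<in> cells C i \<Longrightarrow> y \<in> cells C i \<Longrightarrow> src C i j x = tgt C i j y \<Longrightarrow>
      comp C i j x y \<in> cells C i"
    and src_src: "k < j \<Longrightarrow> j < i \<Longrightarrow> x \<in> cells C i \<Longrightarrow> src C j k (src C i j x) = src C i k x"
    and src_tgt: "k < j \<Longrightarrow> j < i \<Longrightarrow> x \<in> cells C i \<Longrightarrow> src C j k (tgt C i j x) = src C i k x"
    and tgt_src: "k < j \<Longrightarrow> j < i \<Longrightarrow> x \<in> cells C i \<Longrightarrow> tgt C j k (src C i j x) = tgt C i k x"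
    and tgt_tgt: "k < j \<Longrightarrow> j < i \<Longrightarrow> x \<in> cells C i \<Longrightarrow> tgt C j k (tgt C i j x) = tgt C i k x"
    and src_ident: "x \<in> cells C i \<Longrightarrow> src C (Suc i) i (ident C i x) = x"
    and tgt_ident: "x \<in> cells C i \<Longrightarrow> tgt C (Suc i) i (ident C i x) = x"
    and src_comp: "j < i \<Longrightarrow> x \<in> cells C i \<Longrightarrow> y \<in> cells C i \<Longrightarrow> src C i j x = tgt C i j y \<Longrightarrow>
      src C i j (comp C i j x y) = src C i j y"
    and tgt_comp: "j < i \<Longrightarrow> x \<in> cells C i \<Longrightarrow> y \<in> cells C i \<Longrightarrow> src C i j x = tgt C i j y \<Longrightarrow>
      tgt C i j (comp C i j x y) = tgt C i j x"
    and src_comp_high: "j < k \<Longrightarrow> k < i \<Longrightarrow> x \<in> cells C i \<Longrightarrow> y \<in> cells C i \<Longrightarrow>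
      src C i j x = tgt C i j y \<Longrightarrow>
      src C i k (comp C i j x y) = comp C k j (src C i k x) (src C i k y)"
    and tgt_comp_high: "j < k \<Longrightarrow> k < i \<Longrightarrow> x \<in> cells C i \<Longrightarrow> y \<in> cells C i \<Longrightarrow>
      src C i j x = tgt C i j y \<Longrightarrow>
      tgt C i k (comp C i j x y) = comp C k j (tgt C i k x) (tgt C i k y)"
    and comp_assoc: "j < i \<Longrightarrow> x \<in> cells C i \<Longrightarrow> y \<in> cells C i \<Longrightarrow> z \<in> cells C i \<Longrightarrow>
      src C i j x = tgt C i j y \<Longrightarrow> src C i j y = tgt C i j z \<Longrightarrow>
      comp C i j (comp C i j x y) z = comp C i j x (comp C i j y z)"
    and comp_ident_right: "j < i \<Longrightarrow> x \<in> cells C i \<Longrightarrow>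
      comp C i j x (iter_ident C j (i - j) (src C i j x)) = x"
    and comp_ident_left: "j < i \<Longrightarrow> x \<in> cells C i \<Longrightarrow>
      comp C i j (iter_ident C j (i - j) (tgt C i j x)) x = x"
    and ident_comp: "j < i \<Longrightarrow> x \<in> cells C i \<Longrightarrow> y \<in> cells C i \<Longrightarrow> src C i j x = tgt C i j y \<Longrightarrow>
      ident C i (comp C i j x y) = comp C (Suc i) j (ident C i x) (ident C i y)"
    and exchange: "k < j \<Longrightarrow> j < i \<Longrightarrow>
      x \<in> cells C i \<Longrightarrow> y \<in> cells C i \<Longrightarrow> z \<in> cells C i \<Longrightarrow> w \<in> cells C i \<Longrightarrow>
      src C i j x = tgt C i j y \<Longrightarrow> src C i j z = tgt C i j w \<Longrightarrow>
      src C i k x = tgt C i k z \<Longrightarrow> src C i k y = tgt C i k w \<Longrightarrow>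
      comp C i k (comp C i j x y) (comp C i j z w) =
      comp C i j (comp C i k x z) (comp C i k y w)"

locale inf_functor = source: inf_cat C + target: inf_cat D
  for C :: "'c inf_cat_data" and D :: "'d inf_cat_data" +
  fixes F :: "nat \<Rightarrow> 'c \<Rightarrow> 'd"
  assumes map_cells: "F i \<in> cells C i \<rightarrow>\<^sub>E cells D i"
    and map_src: "j < i \<Longrightarrow> x \<in> cells C i \<Longrightarrow> F j (src C i j x) = src D i j (F i x)"
    and map_tgt: "j < i \<Longrightarrow> x \<in> cells C i \<Longrightarrow> F j (tgt C i j x) = tgt D i j (F i x)"
    and map_ident: "x \<in> cells C i \<Longrightarrow> F (Suc i) (ident C i x) = ident D i (F i x)"
    and map_comp: "j < i \<Longrightarrow> x \<in> cells C i \<Longrightarrow> y \<in> cells C i \<Longrightarrow> src C i j x = tgt C i j y \<Longrightarrow>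
      F i (comp C i j x y) = comp D i j (F i x) (F i y)"

definition inf_cat_hom :: "'c inf_cat_data \<Rightarrow> 'd inf_cat_data \<Rightarrow> (nat \<Rightarrow> 'c \<Rightarrow> 'd) set" where
  "inf_cat_hom C D = {F. inf_functor C D F}"


section \<open>The functor nu\<close>

text \<open>A matrix with columns \<open>0, \<dots>, i\<close> is the list of its \<open>i + 1\<close> columns, each a pair
  \<open>(x\<^sup>0\<^sub>k, x\<^sup>1\<^sub>k)\<close>.\<close>

type_synonym 'a matrix = "('a \<times> 'a) list"

definition entry :: "'a matrix \<Rightarrow> bool \<Rightarrow> nat \<Rightarrow> 'a" where
  "entry x \<epsilon> k = (if \<epsilon> then snd (x ! k) else fst (x ! k))"

definition nu_cells :: "'a adc_data \<Rightarrow> nat \<Rightarrow> 'a matrix set" where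
  "nu_cells K i = {x. length x = Suc i \<and>
    (\<forall>\<epsilon>. \<forall>k\<le>i. entry x \<epsilon> k \<in> pos K k) \<and>
    (\<forall>\<epsilon>. \<forall>k<i. diff K (Suc k) (entry x \<epsilon> (Suc k)) =
      entry x True k \<otimes>\<^bsub>chain K k\<^esub> inv\<^bsub>chain K k\<^esub> entry x False k) \<and>
    (\<forall>\<epsilon>. aug K (entry x \<epsilon> 0) = 1) \<and>
    entry x False i = entry x True i}"

definition nu_bound :: "bool \<Rightarrow> nat \<Rightarrow> 'a matrix \<Rightarrow> 'a matrix" where
  "nu_bound \<epsilon> j x = take j x @ [(entry x \<epsilon> j, entry x \<epsilon> j)]"

definition nu_ident :: "'a adc_data \<Rightarrow> nat \<Rightarrow> 'a matrix \<Rightarrow> 'a matrix" where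
  "nu_ident K i x = x @ [(\<one>\<^bsub>chain K (Suc i)\<^esub>, \<one>\<^bsub>chain K (Suc i)\<^esub>)]"

definition nu_comp :: "'a adc_data \<Rightarrow> nat \<Rightarrow> nat \<Rightarrow> 'a matrix \<Rightarrow> 'a matrix \<Rightarrow> 'a matrix" where
  "nu_comp K i j x y = map (\<lambda>k.
      if k < j then y ! k
      else if k = j then (entry y False j, entry x True j)
      else (entry x False k \<otimes>\<^bsub>chain K k\<^esub> entry y False k,
            entry x True k \<otimes>\<^bsub>chain K k\<^esub> entry y True k)) [0..<Suc i]"

definition nu :: "'a adc_data \<Rightarrow> 'a matrix inf_cat_data" where
  "nu K = \<lparr>
    cells = nu_cells K,
    src = (\<lambda>i j. nu_bound False j),
    tgt = (\<lambda>i j. nu_bound True j),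
    ident = nu_ident K,
    comp = nu_comp K\<rparr>"

definition nu_map :: "'a adc_data \<Rightarrow> (nat \<Rightarrow> 'a \<Rightarrow> 'b) \<Rightarrow> nat \<Rightarrow> 'a matrix \<Rightarrow> 'b matrix" where
  "nu_map K f i = (\<lambda>x\<in>nu_cells K i.
    map (\<lambda>k. (f k (entry x False k), f k (entry x True k))) [0..<Suc i])"

definition nu_fully_faithful :: "'a adc_data \<Rightarrow> 'b adc_data \<Rightarrow> bool" where
  "nu_fully_faithful K L \<longleftrightarrow> bij_betw (nu_map K) (adc_hom K L) (inf_cat_hom (nu K) (nu L))"


section \<open>Positive and negative parts are well defined\<close>

context comm_group
begin

lemma lincomb_superset:
  assumes "Poly_Mapping.keys c \<subseteq> S" "finite S" "S \<subseteq> carrier G"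
  shows "lincomb G c = finprod G (\<lambda>b. b [^] Poly_Mapping.lookup c b) S"
  unfolding lincomb_def
  using assms by (intro finprod_mono_neutral_cong_left) (auto simp: in_keys_iff)

lemma lincomb_closed: "Poly_Mapping.keys c \<subseteq> carrier G \<Longrightarrow> lincomb G c \<in> carrier G"
  unfolding lincomb_def by (intro finprod_closed) auto

lemma lincomb_add:
  assumes "Poly_Mapping.keys c \<subseteq> carrier G" "Poly_Mapping.keys d \<subseteq> carrier G"
  shows "lincomb G (c + d) = lincomb G c \<otimes> lincomb G d"
proof -
  define S where "S = Poly_Mapping.keys c \<union> Poly_Mapping.keys d"
  have S: "finite S" "S \<subseteq> carrier G" using assms by (auto simp: S_def)
  have "lincomb G (c + d) = finprod G (\<lambda>b. b [^] Poly_Mapping.lookup (c + d) b) S"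
    using S keys_add[of c d] by (intro lincomb_superset) (auto simp: S_def)
  also have "\<dots> = finprod G (\<lambda>b. b [^] Poly_Mapping.lookup c b \<otimes> b [^] Poly_Mapping.lookup d b) S"
    using S by (intro finprod_cong') (auto simp: lookup_add int_pow_mult)
  also have "\<dots> = lincomb G c \<otimes> lincomb G d"
    using S by (subst finprod_multf) (auto simp: lincomb_superset[of _ S] S_def)
  finally show ?thesis .
qed

lemma lincomb_minus:
  assumes "Poly_Mapping.keys c \<subseteq> carrier G" "Poly_Mapping.keys d \<subseteq> carrier G"
  shows "lincomb G (c - d) = lincomb G c \<otimes> inv (lincomb G d)"
proof -
  have k: "Poly_Mapping.keys (c - d) \<subseteq> carrier G" using keys_diff[of c d] assms by auto
  have "lincomb G c = lincomb G (c - d) \<otimes> lincomb G d"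
    using lincomb_add[OF k assms(2)] by simp
  then show ?thesis
    using inv_solve_right'[OF lincomb_closed[OF assms(1)] lincomb_closed[OF k] lincomb_closed[OF assms(2)]] inv_solve_right lincomb_closed[OF assms(1)] lincomb_closed[OF k] lincomb_closed[OF assms(2)]
    by metis
qed

lemma lincomb_single: "b \<in> carrier G \<Longrightarrow> lincomb G (Poly_Mapping.single b k) = b [^] k"
  by (subst lincomb_superset[of _ "{b}"]) auto

lemma int_basis_coeffs:
  assumes "int_basis G B" "x \<in> carrier G"
  shows "Poly_Mapping.keys (coeffs G B x) \<subseteq> B" "lincomb G (coeffs G B x) = x"
proof -
  have "\<exists>!c. Poly_Mapping.keys c \<subseteq> B \<and> x = lincomb G c"
    using assms unfolding int_basis_def by blast
  from theI'[OF this] show "Poly_Mapping.keys (coeffs G B x) \<subseteq> B" "lincomb G (coeffs G B x) = x"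
    by (simp_all add: coeffs_def)
qed

lemma coeffs_lincomb:
  assumes "int_basis G B" "Poly_Mapping.keys c \<subseteq> B"
  shows "coeffs G B (lincomb G c) = c"
proof -
  have "B \<subseteq> carrier G" using assms(1) by (simp add: int_basis_def)
  then have "lincomb G c \<in> carrier G"
    using assms(2) by (intro lincomb_closed) blast
  then have "\<exists>!d. Poly_Mapping.keys d \<subseteq> B \<and> lincomb G c = lincomb G d"
    using assms(1) by (simp add: int_basis_def)
  then show ?thesis
    unfolding coeffs_def by (rule the1_equality) (simp add: assms(2))
qed

lemma submonoid_hull_eq:
  assumes B: "B \<subseteq> carrier G"
  shows "(\<lambda>M. submonoid M G) hull B =
    {lincomb G c |c. Poly_Mapping.keys c \<subseteq> B \<and> (\<forall>b. 0 \<le> Poly_Mapping.lookup c b)}" (is "_ = ?P")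
proof
  have PI: "x \<in> ?P"
    if "x = lincomb G c" "Poly_Mapping.keys c \<subseteq> B" "\<And>b. 0 \<le> Poly_Mapping.lookup c b" for x c
    using that by blast
  have PE: "\<exists>c. x = lincomb G c \<and> Poly_Mapping.keys c \<subseteq> B \<and> (\<forall>b. 0 \<le> Poly_Mapping.lookup c b)"
    if "x \<in> ?P" for x
    using that by simp
  have "B \<subseteq> ?P"
  proof
    fix b assume b: "b \<in> B"
    show "b \<in> ?P"
    proof (rule PI)
      show "b = lincomb G (Poly_Mapping.single b 1)"
        using b B lincomb_single[of b 1] by auto
    qed (use b in \<open>auto simp: lookup_single when_def\<close>)
  qed
  moreover have "submonoid ?P G"
  proof (rule submonoid.intro)
    show "?P \<subseteq> carrier G"
    proof
      fix x assume "x \<in> ?P"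
      from PE[OF this] show "x \<in> carrier G" using lincomb_closed B by auto
    qed
    show "\<one> \<in> ?P" by (rule PI[of _ 0]) (simp_all add: lincomb_def)
    fix x y assume xy: "x \<in> ?P" "y \<in> ?P"
    from PE[OF xy(1)] obtain c where
      c: "x = lincomb G c" "Poly_Mapping.keys c \<subseteq> B" "\<And>b. 0 \<le> Poly_Mapping.lookup c b" by auto
    from PE[OF xy(2)] obtain d where
      d: "y = lincomb G d" "Poly_Mapping.keys d \<subseteq> B" "\<And>b. 0 \<le> Poly_Mapping.lookup d b" by auto
    show "x \<otimes> y \<in> ?P"
    proof (rule PI)
      have "Poly_Mapping.keys c \<subseteq> carrier G" "Poly_Mapping.keys d \<subseteq> carrier G"
        using c(2) d(2) B by simp_all
      then show "x \<otimes> y = lincomb G (c + d)" by (simp add: lincomb_add c(1) d(1))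
      show "Poly_Mapping.keys (c + d) \<subseteq> B"
        using c(2) d(2) keys_add[of c d] by blast
      show "0 \<le> Poly_Mapping.lookup (c + d) b" for b
        using c(3) d(3) by (simp add: lookup_add)
    qed
  qed
  ultimately show "(\<lambda>M. submonoid M G) hull B \<subseteq> ?P" by (rule hull_minimal)
next
  show "?P \<subseteq> (\<lambda>M. submonoid M G) hull B"
    unfolding hull_def
  proof (intro subsetI InterI, elim CollectE exE conjE)
    fix x c M
    assume x: "x = lincomb G c" and c: "Poly_Mapping.keys c \<subseteq> B" "\<forall>b. 0 \<le> Poly_Mapping.lookup c b"
      and M: "submonoid M G" "B \<subseteq> M"
    interpret M: submonoid M G by fact
    have pow: "b [^] (n::nat) \<in> M" if "b \<in> M" for b n
      using that by (induction n) simp_all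
    have mem: "b [^] Poly_Mapping.lookup c b \<in> M" if "b \<in> B" for b
    proof -
      obtain n where "Poly_Mapping.lookup c b = int n"
        using c(2) zero_le_imp_eq_int by blast
      then show ?thesis using pow[of b n] that M(2) by (simp add: int_pow_int subset_iff)
    qed
    have "finite S \<Longrightarrow> S \<subseteq> B \<Longrightarrow> finprod G (\<lambda>b. b [^] Poly_Mapping.lookup c b) S \<in> M" for S
    proof (induction S rule: finite_induct)
      case (insert b S)
      then have "(\<lambda>b. b [^] Poly_Mapping.lookup c b) \<in> S \<rightarrow> carrier G" "b \<in> carrier G"
        using B by (simp_all add: Pi_iff subset_iff)
      with insert show ?case by (simp add: mem)
    qed simp
    then show "x \<in> M" unfolding x lincomb_def using c by simp
  qed
qed

end

lemma (in adc) pos_neg_parts: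
  assumes B: "adc_basis K B" and x: "x \<in> carrier (chain K i)"
  shows "is_decomposition K B i x q n \<longleftrightarrow> q = pos_part K B i x \<and> n = neg_part K B i x" (is "?decomp")
    and "Poly_Mapping.lookup (coeffs (chain K i) (B i) (pos_part K B i x)) b =
      max 0 (Poly_Mapping.lookup (coeffs (chain K i) (B i) x) b)" (is ?plus)
    and "Poly_Mapping.lookup (coeffs (chain K i) (B i) (neg_part K B i x)) b =
      max 0 (- Poly_Mapping.lookup (coeffs (chain K i) (B i) x) b)" (is ?minus)
proof -
  let ?G = "chain K i" and ?c = "coeffs (chain K i) (B i)"
  interpret comm_group ?G by (rule comm_group_chain)
  have basis: "int_basis ?G (B i)" and pos_eq: "pos K i = (\<lambda>M. submonoid M ?G) hull B i"
    using B by (auto simp: adc_basis_def)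
  have BG: "B i \<subseteq> carrier ?G" using basis by (simp add: int_basis_def)
  note pos_eq = pos_eq[unfolded submonoid_hull_eq[OF BG]]
  define cp where "cp = Poly_Mapping.map (max 0) (?c x)"
  define cm where "cm = Poly_Mapping.map (\<lambda>a. max 0 (- a)) (?c x)"
  have lcp: "Poly_Mapping.lookup cp b = max 0 (Poly_Mapping.lookup (?c x) b)" for b
    by (simp add: cp_def Poly_Mapping.map.rep_eq when_def)
  have lcm: "Poly_Mapping.lookup cm b = max 0 (- Poly_Mapping.lookup (?c x) b)" for b
    by (simp add: cm_def Poly_Mapping.map.rep_eq when_def)
  note cx = int_basis_coeffs[OF basis x]
  have keys: "Poly_Mapping.keys cp \<subseteq> B i" "Poly_Mapping.keys cm \<subseteq> B i"
  proof -
    have "Poly_Mapping.keys cp \<subseteq> Poly_Mapping.keys (?c x)" "Poly_Mapping.keys cm \<subseteq> Poly_Mapping.keys (?c x)"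
      by (auto simp: in_keys_iff lcp lcm)
    with cx(1) show "Poly_Mapping.keys cp \<subseteq> B i" "Poly_Mapping.keys cm \<subseteq> B i" by simp_all
  qed
  have "cp - cm = ?c x"
    by (rule poly_mapping_eqI) (simp add: lookup_minus lcp lcm)
  then have "x = lincomb ?G cp \<otimes>\<^bsub>?G\<^esub> inv\<^bsub>?G\<^esub> lincomb ?G cm"
    using lincomb_minus[of cp cm] keys[THEN subset_trans, OF BG] cx(2) by simp
  moreover have "Poly_Mapping.keys cp \<inter> Poly_Mapping.keys cm = {}"
    by (auto simp: in_keys_iff lcp lcm)
  moreover have "lincomb ?G cp \<in> pos K i"
    unfolding pos_eq using keys(1) lcp by (auto intro!: exI[of _ cp])
  moreover have "lincomb ?G cm \<in> pos K i"
    unfolding pos_eq using keys(2) lcm by (auto intro!: exI[of _ cm])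
  ultimately have ex: "is_decomposition K B i x (lincomb ?G cp) (lincomb ?G cm)"
    by (simp add: is_decomposition_def supp_def coeffs_lincomb[OF basis] keys)
  have uniq: "p = lincomb ?G cp \<and> m = lincomb ?G cm" if "is_decomposition K B i x p m" for p m
  proof -
    note d = that[unfolded is_decomposition_def]
    obtain c where c: "p = lincomb ?G c" "Poly_Mapping.keys c \<subseteq> B i" "\<And>b. 0 \<le> Poly_Mapping.lookup c b"
      using d unfolding pos_eq by auto
    obtain c' where c': "m = lincomb ?G c'" "Poly_Mapping.keys c' \<subseteq> B i" "\<And>b. 0 \<le> Poly_Mapping.lookup c' b"
      using d unfolding pos_eq by auto
    have "Poly_Mapping.keys c \<subseteq> carrier ?G" "Poly_Mapping.keys c' \<subseteq> carrier ?G"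
      using c(2) c'(2) BG by simp_all
    then have "x = lincomb ?G (c - c')"
      using d by (simp add: lincomb_minus c(1) c'(1))
    moreover have "Poly_Mapping.keys (c - c') \<subseteq> B i"
      using keys_diff[of c c'] c c' by blast
    ultimately have eq: "?c x = c - c'" using coeffs_lincomb[OF basis] by simp
    have disj: "Poly_Mapping.lookup c b = 0 \<or> Poly_Mapping.lookup c' b = 0" for b
    proof -
      have "Poly_Mapping.keys c \<inter> Poly_Mapping.keys c' = {}"
        using d by (simp add: supp_def c(1) c'(1) coeffs_lincomb[OF basis] c(2) c'(2))
      then show ?thesis by (auto simp: in_keys_iff disjoint_iff)
    qed
    have "c = cp"
    proof (rule poly_mapping_eqI)
      show "Poly_Mapping.lookup c b = Poly_Mapping.lookup cp b" for b
        using disj[of b] c(3)[of b] c'(3)[of b] by (auto simp: lcp eq lookup_minus)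
    qed
    moreover have "c' = cm"
    proof (rule poly_mapping_eqI)
      show "Poly_Mapping.lookup c' b = Poly_Mapping.lookup cm b" for b
        using disj[of b] c(3)[of b] c'(3)[of b] by (auto simp: lcm eq lookup_minus)
    qed
    ultimately show ?thesis using c(1) c'(1) by simp
  qed
  have p: "pos_part K B i x = lincomb ?G cp"
    unfolding pos_part_def
  proof (rule the_equality)
    show "\<exists>m. is_decomposition K B i x (lincomb ?G cp) m" by (rule exI) (rule ex)
  qed (elim exE, drule uniq, elim conjE)
  have m: "neg_part K B i x = lincomb ?G cm"
    unfolding neg_part_def
  proof (rule the_equality)
    show "\<exists>p. is_decomposition K B i x p (lincomb ?G cm)" by (rule exI) (rule ex)
  qed (elim exE, drule uniq, elim conjE)
  show ?decomp
  proof
    assume "is_decomposition K B i x q n"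
    from uniq[OF this] show "q = pos_part K B i x \<and> n = neg_part K B i x" by (simp add: p m)
  next
    assume "q = pos_part K B i x \<and> n = neg_part K B i x"
    then show "is_decomposition K B i x q n" using ex by (simp add: p m)
  qed
  show ?plus ?minus
    by (simp_all add: p m coeffs_lincomb[OF basis] keys lcp lcm)
qed


section \<open>nu is a functor to strict infinity-categories\<close>

lemma matrix_eqI:
  assumes "length x = length y" and "\<And>\<epsilon> k. k < length x \<Longrightarrow> entry x \<epsilon> k = entry y \<epsilon> k"
  shows "x = y"
proof (rule nth_equalityI)
  fix k assume "k < length x"
  then show "x ! k = y ! k"
    using assms(2)[of k False] assms(2)[of k True] by (simp add: entry_def prod_eq_iff)
qed (fact assms(1))

lemma length_nu_bound: "j < length x \<Longrightarrow> length (nu_bound \<epsilon> j x) = Suc j"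
  by (simp add: nu_bound_def)

lemma entry_nu_bound:
  "j < length x \<Longrightarrow> k \<le> j \<Longrightarrow>
    entry (nu_bound \<epsilon> j x) \<delta> k = (if k < j then entry x \<delta> k else entry x \<epsilon> j)"
  by (simp add: nu_bound_def entry_def nth_append)

lemma length_nu_comp: "length (nu_comp K i j x y) = Suc i"
  by (simp add: nu_comp_def)

lemma entry_nu_comp:
  "k \<le> i \<Longrightarrow> entry (nu_comp K i j x y) \<epsilon> k =
    (if k < j then entry y \<epsilon> k
     else if k = j then (if \<epsilon> then entry x True j else entry y False j)
     else entry x \<epsilon> k \<otimes>\<^bsub>chain K k\<^esub> entry y \<epsilon> k)"
  by (simp add: nu_comp_def entry_def del: upt_Suc)

lemma length_nu_ident: "length (nu_ident K i x) = Suc (length x)"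
  by (simp add: nu_ident_def)

lemma entry_nu_ident:
  "length x = Suc i \<Longrightarrow> k \<le> Suc i \<Longrightarrow>
    entry (nu_ident K i x) \<epsilon> k = (if k \<le> i then entry x \<epsilon> k else \<one>\<^bsub>chain K k\<^esub>)"
  by (auto simp: nu_ident_def entry_def nth_append le_Suc_eq)

lemma iter_ident_nu:
  assumes "length x = Suc j"
  shows "length (iter_ident (nu K) j r x) = Suc (j + r) \<and>
    (\<forall>\<epsilon>. \<forall>k\<le>j + r. entry (iter_ident (nu K) j r x) \<epsilon> k =
      (if k \<le> j then entry x \<epsilon> k else \<one>\<^bsub>chain K k\<^esub>))"
  by (induction r) (auto simp: assms nu_def length_nu_ident entry_nu_ident)

lemma nu_boundary_eqD:
  assumes "nu_bound False j x = nu_bound True j y" "j < length x" "j < length y"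
  shows "k < j \<Longrightarrow> entry y \<epsilon> k = entry x \<epsilon> k" "entry x False j = entry y True j"
  using entry_nu_bound[of j x k False \<epsilon>] entry_nu_bound[of j y k True \<epsilon>]
    entry_nu_bound[of j x j False True] entry_nu_bound[of j y j True True] assms
  by auto

context adc
begin

lemma pos_closed: "x \<in> pos K i \<Longrightarrow> x \<in> carrier (chain K i)"
  using submonoid_pos submonoid.subset by blast

lemma diff_mult: "x \<in> carrier (chain K (Suc i)) \<Longrightarrow> y \<in> carrier (chain K (Suc i)) \<Longrightarrow>
    diff K (Suc i) (x \<otimes>\<^bsub>chain K (Suc i)\<^esub> y) = diff K (Suc i) x \<otimes>\<^bsub>chain K i\<^esub> diff K (Suc i) y"
  using diff_hom[of i] by (simp add: hom_mult)

lemma diff_one: "diff K (Suc i) \<one>\<^bsub>chain K (Suc i)\<^esub> = \<one>\<^bsub>chain K i\<^esub>"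
  using hom_one[OF diff_hom] comm_group_chain by (simp add: comm_group_def)

lemma nu_cellD:
  assumes "x \<in> nu_cells K i"
  shows "length x = Suc i" "k \<le> i \<Longrightarrow> entry x \<epsilon> k \<in> pos K k"
    "k \<le> i \<Longrightarrow> entry x \<epsilon> k \<in> carrier (chain K k)"
    "k < i \<Longrightarrow> diff K (Suc k) (entry x \<epsilon> (Suc k)) =
      entry x True k \<otimes>\<^bsub>chain K k\<^esub> inv\<^bsub>chain K k\<^esub> entry x False k"
    "aug K (entry x \<epsilon> 0) = 1" "entry x False i = entry x True i"
  using assms by (auto simp: nu_cells_def pos_closed)

lemma nu_cell_top: "x \<in> nu_cells K i \<Longrightarrow> entry x \<epsilon> i = entry x True i"
  by (cases \<epsilon>) (auto simp: nu_cells_def)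

lemma telescope:
  assumes "a \<in> carrier (chain K k)" "b \<in> carrier (chain K k)" "c \<in> carrier (chain K k)"
  shows "(b \<otimes>\<^bsub>chain K k\<^esub> inv\<^bsub>chain K k\<^esub> a) \<otimes>\<^bsub>chain K k\<^esub> (a \<otimes>\<^bsub>chain K k\<^esub> inv\<^bsub>chain K k\<^esub> c) =
    b \<otimes>\<^bsub>chain K k\<^esub> inv\<^bsub>chain K k\<^esub> c"
proof -
  interpret comm_group "chain K k" by (rule comm_group_chain)
  show ?thesis using assms
    by (metis inv_closed inv_solve_left m_assoc m_closed)
qed

lemma sum_of_differences:
  assumes "a \<in> carrier (chain K k)" "b \<in> carrier (chain K k)" "c \<in> carrier (chain K k)"
    "d \<in> carrier (chain K k)"
  shows "(a \<otimes>\<^bsub>chain K k\<^esub> inv\<^bsub>chain K k\<^esub> b) \<otimes>\<^bsub>chain K k\<^esub> (c \<otimes>\<^bsub>chain K k\<^esub> inv\<^bsub>chain K k\<^esub> d) =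
    (a \<otimes>\<^bsub>chain K k\<^esub> c) \<otimes>\<^bsub>chain K k\<^esub> inv\<^bsub>chain K k\<^esub> (b \<otimes>\<^bsub>chain K k\<^esub> d)"
proof -
  interpret comm_group "chain K k" by (rule comm_group_chain)
  show ?thesis using assms by (simp add: inv_mult m_ac)
qed

lemma nu_bound_cell:
  assumes "x \<in> nu_cells K i" "j < i"
  shows "nu_bound \<epsilon> j x \<in> nu_cells K j"
proof -
  note x = nu_cellD[OF assms(1)]
  have "diff K (Suc k) (entry (nu_bound \<epsilon> j x) \<delta> (Suc k)) =
      entry (nu_bound \<epsilon> j x) True k \<otimes>\<^bsub>chain K k\<^esub> inv\<^bsub>chain K k\<^esub> entry (nu_bound \<epsilon> j x) False k"
    if "k < j" for k \<delta>
    using that assms(2) x(1) x(4)[of k]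
    by (cases "Suc k = j") (auto simp: entry_nu_bound)
  then show ?thesis
    using assms(2) x(1,2,5) unfolding nu_cells_def
    by (auto simp: length_nu_bound entry_nu_bound)
qed

lemma nu_ident_cell:
  assumes "x \<in> nu_cells K i"
  shows "nu_ident K i x \<in> nu_cells K (Suc i)"
proof -
  note x = nu_cellD[OF assms(1)]
  interpret comm_group "chain K i" by (rule comm_group_chain)
  have "entry x True i \<otimes>\<^bsub>chain K i\<^esub> inv\<^bsub>chain K i\<^esub> entry x True i = \<one>\<^bsub>chain K i\<^esub>"
    using x(3)[of i] by simp
  moreover have "\<one>\<^bsub>chain K k\<^esub> \<in> pos K k" for k
    using submonoid_pos submonoid.one_closed by blast
  ultimately show ?thesis
    using x(2-) unfolding nu_cells_def
    by (auto simp: x(1) length_nu_ident entry_nu_ident diff_one less_Suc_eq)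
qed

lemma nu_comp_cell:
  assumes "x \<in> nu_cells K i" "y \<in> nu_cells K i" "j < i"
    and b: "nu_bound False j x = nu_bound True j y"
  shows "nu_comp K i j x y \<in> nu_cells K i"
proof -
  note x = nu_cellD[OF assms(1)] and y = nu_cellD[OF assms(2)]
  have b1: "entry y \<epsilon> k = entry x \<epsilon> k" if "k < j" for \<epsilon> k
    using nu_boundary_eqD(1)[OF b] x(1) y(1) assms(3) that by simp
  have b2: "entry x False j = entry y True j"
    using nu_boundary_eqD(2)[OF b] x(1) y(1) assms(3) by simp
  have "diff K (Suc k) (entry (nu_comp K i j x y) \<epsilon> (Suc k)) =
      entry (nu_comp K i j x y) True k \<otimes>\<^bsub>chain K k\<^esub> inv\<^bsub>chain K k\<^esub> entry (nu_comp K i j x y) False k"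
    if "k < i" for k \<epsilon>
  proof -
    consider "Suc k < j" | "Suc k = j" | "k = j" | "j < k" by linarith
    then show ?thesis
    proof cases
      case 3
      then show ?thesis
        using that x(3)[of k] y(3)[of k]
        by (simp add: entry_nu_comp diff_mult x(3) y(3) x(4) y(4) b2[symmetric])
          (simp add: telescope b2 x(3) y(3) flip: b2)
    next
      case 4
      then show ?thesis
        using that
        by (simp add: entry_nu_comp diff_mult x(3) y(3) x(4) y(4) sum_of_differences)
    qed (use that x(4) y(4) b1 in \<open>auto simp: entry_nu_comp\<close>)
  qed
  moreover have "entry (nu_comp K i j x y) \<epsilon> k \<in> pos K k" if "k \<le> i" for k \<epsilon>
    using that x(2)[of k] y(2)[of k] submonoid.m_closed[OF submonoid_pos[of k]]
    by (auto simp: entry_nu_comp)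
  moreover have "aug K (entry (nu_comp K i j x y) \<epsilon> 0) = 1" for \<epsilon>
    using assms(3) x(5) y(5) by (auto simp: entry_nu_comp)
  moreover have "entry (nu_comp K i j x y) False i = entry (nu_comp K i j x y) True i"
    using assms(3) x(6) y(6) by (simp add: entry_nu_comp)
  ultimately show ?thesis
    by (simp add: nu_cells_def length_nu_comp)
qed

theorem inf_cat_nu: "inf_cat (nu K)"
proof (standard, goal_cases)
  case (4 j i x y)
  then show ?case by (simp add: nu_def nu_comp_cell)
next
  case (15 j i x y z)
  note c = 15[unfolded nu_def, simplified]
  note x = nu_cellD[OF c(2)] and y = nu_cellD[OF c(3)] and z = nu_cellD[OF c(4)]
  have "(entry x \<epsilon> k \<otimes>\<^bsub>chain K k\<^esub> entry y \<epsilon> k) \<otimes>\<^bsub>chain K k\<^esub> entry z \<epsilon> k =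
    entry x \<epsilon> k \<otimes>\<^bsub>chain K k\<^esub> (entry y \<epsilon> k \<otimes>\<^bsub>chain K k\<^esub> entry z \<epsilon> k)" if "k \<le> i" for k \<epsilon>
  proof -
    interpret comm_group "chain K k" by (rule comm_group_chain)
    show ?thesis using that x(3) y(3) z(3) by (simp add: m_assoc)
  qed
  then show ?case
    by (auto simp: nu_def intro!: matrix_eqI) (auto simp: length_nu_comp entry_nu_comp)
next
  case (16 j i x)
  note c = 16[unfolded nu_def, simplified]
  note x = nu_cellD[OF c(2)]
  have l: "length (nu_bound False j x) = Suc j" using x(1) c(1) by (simp add: length_nu_bound)
  have "entry x \<epsilon> k \<otimes>\<^bsub>chain K k\<^esub> \<one>\<^bsub>chain K k\<^esub> = entry x \<epsilon> k" if "k \<le> i" for k \<epsilon>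
  proof -
    interpret comm_group "chain K k" by (rule comm_group_chain)
    show ?thesis using that x(3) by simp
  qed
  then have "nu_comp K i j x (iter_ident (nu K) j (i - j) (nu_bound False j x)) = x"
    using c(1) x(1) iter_ident_nu[OF l, of K "i - j"]
    by (intro matrix_eqI) (auto simp: length_nu_comp entry_nu_comp entry_nu_bound)
  then show ?case by (simp add: nu_def)
next
  case (17 j i x)
  note c = 17[unfolded nu_def, simplified]
  note x = nu_cellD[OF c(2)]
  have l: "length (nu_bound True j x) = Suc j" using x(1) c(1) by (simp add: length_nu_bound)
  have "\<one>\<^bsub>chain K k\<^esub> \<otimes>\<^bsub>chain K k\<^esub> entry x \<epsilon> k = entry x \<epsilon> k" if "k \<le> i" for k \<epsilon>
  proof -
    interpret comm_group "chain K k" by (rule comm_group_chain)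
    show ?thesis using that x(3) by simp
  qed
  then have "nu_comp K i j (iter_ident (nu K) j (i - j) (nu_bound True j x)) x = x"
    using c(1) x(1) iter_ident_nu[OF l, of K "i - j"]
    by (intro matrix_eqI) (auto simp: length_nu_comp entry_nu_comp entry_nu_bound)
  then show ?case by (simp add: nu_def)
next
  case (18 j i x y)
  note c = 18[unfolded nu_def, simplified]
  note x = nu_cellD[OF c(2)] and y = nu_cellD[OF c(3)]
  have "\<one>\<^bsub>chain K k\<^esub> \<otimes>\<^bsub>chain K k\<^esub> \<one>\<^bsub>chain K k\<^esub> = \<one>\<^bsub>chain K k\<^esub>" for k
  proof -
    interpret comm_group "chain K k" by (rule comm_group_chain)
    show ?thesis by simp
  qed
  then have "nu_ident K i (nu_comp K i j x y) = nu_comp K (Suc i) j (nu_ident K i x) (nu_ident K i y)"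
    using c(1)
    by (intro matrix_eqI)
      (auto simp: length_nu_comp length_nu_ident entry_nu_comp entry_nu_ident x(1) y(1))
  then show ?case by (simp add: nu_def)
next
  case (19 k j i x y z w)
  note c = 19[unfolded nu_def, simplified]
  note x = nu_cellD[OF c(3)] and y = nu_cellD[OF c(4)] and z = nu_cellD[OF c(5)] and w = nu_cellD[OF c(6)]
  have b1: "entry y \<epsilon> l = entry x \<epsilon> l" "entry w \<epsilon> l = entry z \<epsilon> l" if "l < j" for \<epsilon> l
    using nu_boundary_eqD(1)[OF c(7)] nu_boundary_eqD(1)[OF c(8)] x(1) y(1) z(1) w(1) c(1,2) that
    by simp_all
  have *: "(entry x \<epsilon> l \<otimes>\<^bsub>chain K l\<^esub> entry y \<epsilon> l) \<otimes>\<^bsub>chain K l\<^esub> (entry z \<epsilon> l \<otimes>\<^bsub>chain K l\<^esub> entry w \<epsilon> l) =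
    (entry x \<epsilon> l \<otimes>\<^bsub>chain K l\<^esub> entry z \<epsilon> l) \<otimes>\<^bsub>chain K l\<^esub> (entry y \<epsilon> l \<otimes>\<^bsub>chain K l\<^esub> entry w \<epsilon> l)"
    if "l \<le> i" for l \<epsilon>
  proof -
    interpret comm_group "chain K l" by (rule comm_group_chain)
    show ?thesis using that x(3)[of l] y(3)[of l] z(3)[of l] w(3)[of l] by (simp add: m_ac)
  qed
  have "nu_comp K i k (nu_comp K i j x y) (nu_comp K i j z w) =
      nu_comp K i j (nu_comp K i k x z) (nu_comp K i k y w)"
    using c(1,2) b1
    by (intro matrix_eqI) (auto simp: length_nu_comp entry_nu_comp *)
  then show ?case by (simp add: nu_def)
qed (auto simp: nu_def nu_bound_cell nu_ident_cell length_nu_bound entry_nu_bound length_nu_comp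
    entry_nu_comp length_nu_ident entry_nu_ident nu_cellD less_Suc_eq_le nu_boundary_eqD
    intro!: matrix_eqI nu_cell_top[symmetric])

end

context adc
begin

lemma diff_closed: "x \<in> carrier (chain K (Suc i)) \<Longrightarrow> diff K (Suc i) x \<in> carrier (chain K i)"
  using diff_hom[of i] by (auto simp: hom_def)

lemma adc_morphism_id: "adc_morphism K K (adc_id K)"
proof -
  have "adc_id K i \<in> hom (chain K i) (chain K i)" for i
  proof -
    interpret comm_group "chain K i" by (rule comm_group_chain)
    show ?thesis by (auto simp: hom_def adc_id_def)
  qed
  then show ?thesis
    by unfold_locales (auto simp: adc_id_def pos_closed diff_closed)
qed

end

context adc_morphism
begin

lemma map_carrier: "x \<in> carrier (chain K i) \<Longrightarrow> f i x \<in> carrier (chain L i)"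
  using map_hom[of i] by (auto simp: hom_def)

lemma map_mult: "x \<in> carrier (chain K i) \<Longrightarrow> y \<in> carrier (chain K i) \<Longrightarrow>
    f i (x \<otimes>\<^bsub>chain K i\<^esub> y) = f i x \<otimes>\<^bsub>chain L i\<^esub> f i y"
  using map_hom[of i] by (simp add: hom_mult)

lemma map_one: "f i \<one>\<^bsub>chain K i\<^esub> = \<one>\<^bsub>chain L i\<^esub>"
  using hom_one[OF map_hom] source.comm_group_chain target.comm_group_chain
  by (simp add: comm_group_def)

lemma map_minus:
  assumes "x \<in> carrier (chain K i)" "y \<in> carrier (chain K i)"
  shows "f i (x \<otimes>\<^bsub>chain K i\<^esub> inv\<^bsub>chain K i\<^esub> y) = f i x \<otimes>\<^bsub>chain L i\<^esub> inv\<^bsub>chain L i\<^esub> f i y"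
proof -
  interpret G: comm_group "chain K i" by (rule source.comm_group_chain)
  interpret H: comm_group "chain L i" by (rule target.comm_group_chain)
  interpret group_hom "chain K i" "chain L i" "f i"
    by unfold_locales (rule map_hom)
  show ?thesis using assms by simp
qed

lemma adc_morphism_compose:
  assumes "adc_morphism L M g"
  shows "adc_morphism K M (adc_compose K g f)"
proof -
  interpret g: adc_morphism L M g by fact
  have "adc_compose K g f i \<in> hom (chain K i) (chain M i)" for i
  proof -
    interpret comm_group "chain K i" by (rule source.comm_group_chain)
    show ?thesis
      by (auto simp: hom_def adc_compose_def compose_def map_carrier g.map_carrier map_mult g.map_mult)
  qed
  moreover have "adc_compose K g f i ` pos K i \<subseteq> pos M i" for i
    using map_pos[of i] g.map_pos[of i] source.pos_closed
    by (auto simp: adc_compose_def compose_def)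
  ultimately show ?thesis
    by unfold_locales (auto simp: adc_compose_def compose_def source.diff_closed map_carrier
        map_diff g.map_diff map_aug g.map_aug)
qed

lemma nu_map_eq: "x \<in> nu_cells K i \<Longrightarrow> length (nu_map K f i x) = Suc i"
  "x \<in> nu_cells K i \<Longrightarrow> k \<le> i \<Longrightarrow> entry (nu_map K f i x) \<epsilon> k = f k (entry x \<epsilon> k)"
  by (auto simp: nu_map_def entry_def simp del: upt_Suc)

lemma nu_map_cell:
  assumes "x \<in> nu_cells K i"
  shows "nu_map K f i x \<in> nu_cells L i"
proof -
  note x = source.nu_cellD[OF assms]
  have "f k (entry x \<epsilon> k) \<in> pos L k" if "k \<le> i" for \<epsilon> k
    using map_pos[of k] x(2) that by auto
  moreover have "diff L (Suc k) (f (Suc k) (entry x \<epsilon> (Suc k))) =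
      f k (entry x True k) \<otimes>\<^bsub>chain L k\<^esub> inv\<^bsub>chain L k\<^esub> f k (entry x False k)" if "k < i" for \<epsilon> k
    using that by (simp add: x(3,4) map_minus flip: map_diff)
  ultimately show ?thesis
    unfolding nu_cells_def using x(3,5,6) by (simp add: nu_map_eq assms map_aug)
qed

theorem inf_functor_nu_map: "inf_functor (nu K) (nu L) (nu_map K f)"
proof (intro inf_functor.intro inf_functor_axioms.intro source.inf_cat_nu target.inf_cat_nu,
    goal_cases)
  case (1 i)
  then show ?case
    by (auto simp: nu_def nu_map_cell PiE_def) (auto simp: nu_map_def)
next
  case (2 j i x)
  then have c: "j < i" "x \<in> nu_cells K i" by (simp_all add: nu_def)
  then show ?case
    by (auto simp: nu_def nu_map_eq source.nu_bound_cell length_nu_bound entry_nu_bound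
        source.nu_cellD(1)[OF c(2)] less_Suc_eq intro!: matrix_eqI)
next
  case (3 j i x)
  then have c: "j < i" "x \<in> nu_cells K i" by (simp_all add: nu_def)
  then show ?case
    by (auto simp: nu_def nu_map_eq source.nu_bound_cell length_nu_bound entry_nu_bound
        source.nu_cellD(1)[OF c(2)] less_Suc_eq intro!: matrix_eqI)
next
  case (4 x i)
  then have c: "x \<in> nu_cells K i" by (simp_all add: nu_def)
  then show ?case
    by (auto simp: nu_def nu_map_eq source.nu_ident_cell length_nu_ident entry_nu_ident
        source.nu_cellD(1)[OF c] map_one intro!: matrix_eqI)
next
  case (5 j i x y)
  then have c: "j < i" "x \<in> nu_cells K i" "y \<in> nu_cells K i"
    "nu_bound False j x = nu_bound True j y" by (simp_all add: nu_def)
  note x = source.nu_cellD[OF c(2)] and y = source.nu_cellD[OF c(3)]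
  have "nu_map K f i (nu_comp K i j x y) = nu_comp L i j (nu_map K f i x) (nu_map K f i y)"
    using c(1-3) source.nu_comp_cell[OF c(2,3,1,4)] x(3) y(3)
    by (intro matrix_eqI) (auto simp: nu_map_eq length_nu_comp entry_nu_comp map_mult)
  then show ?case by (simp add: nu_def)
qed

end

lemma (in adc) nu_map_id: "nu_map K (adc_id K) i = (\<lambda>x\<in>nu_cells K i. x)"
proof -
  interpret adc_morphism K K "adc_id K" by (rule adc_morphism_id)
  have "nu_map K (adc_id K) i x = x" if "x \<in> nu_cells K i" for x
    using that nu_cellD[OF that] by (intro matrix_eqI) (auto simp: nu_map_eq adc_id_def)
  then show ?thesis by (auto simp: nu_map_def)
qed

lemma nu_map_compose:
  assumes "adc_morphism K L f" "adc_morphism L M g"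
  shows "nu_map K (adc_compose K g f) i = compose (nu_cells K i) (nu_map L g i) (nu_map K f i)"
proof -
  interpret f: adc_morphism K L f by fact
  interpret g: adc_morphism L M g by fact
  interpret gf: adc_morphism K M "adc_compose K g f" by (rule f.adc_morphism_compose) fact
  have "nu_map K (adc_compose K g f) i x = nu_map L g i (nu_map K f i x)"
    if "x \<in> nu_cells K i" for x
    using that f.source.nu_cellD[OF that] f.nu_map_cell[OF that]
    by (intro matrix_eqI)
      (auto simp: f.nu_map_eq g.nu_map_eq gf.nu_map_eq adc_compose_def compose_def)
  then show ?thesis by (auto simp: compose_def nu_map_def)
qed


section \<open>Truncations are augmented directed complexes\<close>

context adc
begin

lemma subgroup_trunc_sub: "subgroup (trunc_sub K n i) (chain K i)"
proof -
  interpret comm_group "chain K i" by (rule comm_group_chain)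
  interpret G: comm_group "chain K (Suc n)" by (rule comm_group_chain)
  interpret H: comm_group "chain K n" by (rule comm_group_chain)
  interpret d: group_hom "chain K (Suc n)" "chain K n" "diff K (Suc n)"
    by unfold_locales (rule diff_hom)
  show ?thesis
    using d.img_is_subgroup by (auto simp: trunc_sub_def triv_subgroup subgroup_self)
qed

lemma diff_trunc_sub: "h \<in> trunc_sub K n (Suc i) \<Longrightarrow> diff K (Suc i) h \<in> trunc_sub K n i"
  by (auto simp: trunc_sub_def diff_one diff_diff diff_closed split: if_splits)

lemma diff_trunc:
  assumes x: "x \<in> carrier (chain K (Suc i))"
  shows "diff (trunc n K) (Suc i) (trunc_sub K n (Suc i) #>\<^bsub>chain K (Suc i)\<^esub> x) =
    trunc_sub K n i #>\<^bsub>chain K i\<^esub> diff K (Suc i) x"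
proof -
  interpret comm_group "chain K i" by (rule comm_group_chain)
  interpret G: comm_group "chain K (Suc i)" by (rule comm_group_chain)
  interpret N: subgroup "trunc_sub K n i" "chain K i" by (rule subgroup_trunc_sub)
  interpret M: subgroup "trunc_sub K n (Suc i)" "chain K (Suc i)" by (rule subgroup_trunc_sub)
  have "h \<otimes>\<^bsub>chain K i\<^esub> diff K (Suc i) (m \<otimes>\<^bsub>chain K (Suc i)\<^esub> x) \<in> trunc_sub K n i #>\<^bsub>chain K i\<^esub> diff K (Suc i) x"
    if "h \<in> trunc_sub K n i" "m \<in> trunc_sub K n (Suc i)" for h m
  proof -
    have "h \<otimes>\<^bsub>chain K i\<^esub> diff K (Suc i) (m \<otimes>\<^bsub>chain K (Suc i)\<^esub> x) =
      (h \<otimes>\<^bsub>chain K i\<^esub> diff K (Suc i) m) \<otimes>\<^bsub>chain K i\<^esub> diff K (Suc i) x"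
      using that x by (simp add: diff_mult M.mem_carrier m_assoc diff_closed N.mem_carrier)
    then show ?thesis
      using that diff_trunc_sub[OF that(2)] by (auto simp: r_coset_def)
  qed
  then have "diff (trunc n K) (Suc i) (trunc_sub K n (Suc i) #>\<^bsub>chain K (Suc i)\<^esub> x) \<subseteq>
      trunc_sub K n i #>\<^bsub>chain K i\<^esub> diff K (Suc i) x"
    unfolding trunc_def set_mult_def r_coset_def[of "chain K (Suc i)"] by auto
  moreover have "x \<in> trunc_sub K n (Suc i) #>\<^bsub>chain K (Suc i)\<^esub> x"
    by (rule G.rcos_self[OF x subgroup_trunc_sub])
  then have "trunc_sub K n i #>\<^bsub>chain K i\<^esub> diff K (Suc i) x \<subseteq>
      diff (trunc n K) (Suc i) (trunc_sub K n (Suc i) #>\<^bsub>chain K (Suc i)\<^esub> x)"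
    unfolding trunc_def set_mult_def r_coset_def[of "chain K i"] by auto
  ultimately show ?thesis by (rule equalityI)
qed

lemma aug_trunc:
  assumes x: "x \<in> carrier (chain K 0)"
  shows "aug (trunc n K) (trunc_sub K n 0 #>\<^bsub>chain K 0\<^esub> x) = aug K x"
proof -
  interpret comm_group "chain K 0" by (rule comm_group_chain)
  interpret N: subgroup "trunc_sub K n 0" "chain K 0" by (rule subgroup_trunc_sub)
  have "aug K \<one>\<^bsub>chain K 0\<^esub> = 0"
    using hom_one[OF aug_hom] by simp
  then have "aug K h = 0" if "h \<in> trunc_sub K n 0" for h
    using that aug_diff by (auto simp: trunc_sub_def split: if_splits)
  then have "aug K (h \<otimes>\<^bsub>chain K 0\<^esub> x) = aug K x" if "h \<in> trunc_sub K n 0" for h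
    using that x hom_mult[OF aug_hom, of h x] by (simp add: N.mem_carrier)
  then have "aug K ` (trunc_sub K n 0 #>\<^bsub>chain K 0\<^esub> x) = {aug K x}"
    using rcos_self[OF x subgroup_trunc_sub, of n] by (force simp: r_coset_def)
  then show ?thesis by (simp add: trunc_def)
qed

theorem adc_trunc: "adc (trunc n K)"
proof -
  have carrier: "carrier (chain (trunc n K) i) =
      (\<lambda>x. trunc_sub K n i #>\<^bsub>chain K i\<^esub> x) ` carrier (chain K i)" for i
    by (simp add: trunc_def carrier_FactGroup)
  have one: "\<one>\<^bsub>chain (trunc n K) i\<^esub> = trunc_sub K n i #>\<^bsub>chain K i\<^esub> \<one>\<^bsub>chain K i\<^esub>" for i
  proof -
    interpret comm_group "chain K i" by (rule comm_group_chain)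
    show ?thesis using subgroup.subset[OF subgroup_trunc_sub] by (simp add: trunc_def)
  qed
  have mult: "(trunc_sub K n i #>\<^bsub>chain K i\<^esub> x) \<otimes>\<^bsub>chain (trunc n K) i\<^esub> (trunc_sub K n i #>\<^bsub>chain K i\<^esub> y) =
      trunc_sub K n i #>\<^bsub>chain K i\<^esub> (x \<otimes>\<^bsub>chain K i\<^esub> y)"
    if "x \<in> carrier (chain K i)" "y \<in> carrier (chain K i)" for i x y
  proof -
    interpret comm_group "chain K i" by (rule comm_group_chain)
    show ?thesis
      using normal.rcos_sum[OF subgroup_imp_normal[OF subgroup_trunc_sub] that]
      by (simp add: trunc_def)
  qed
  have closed: "x \<otimes>\<^bsub>chain K i\<^esub> y \<in> carrier (chain K i)"
    if "x \<in> carrier (chain K i)" "y \<in> carrier (chain K i)" for i x y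
  proof -
    interpret comm_group "chain K i" by (rule comm_group_chain)
    show ?thesis using that by simp
  qed
  show ?thesis
  proof (rule adc.intro)
    fix i
    interpret comm_group "chain K i" by (rule comm_group_chain)
    show "comm_group (chain (trunc n K) i)"
      using abelian_FactGroup[OF subgroup_trunc_sub] by (simp add: trunc_def)
    interpret P: submonoid "pos K i" "chain K i" by (rule submonoid_pos)
    have "pos (trunc n K) i = (\<lambda>x. trunc_sub K n i #>\<^bsub>chain K i\<^esub> x) ` pos K i"
      by (simp add: trunc_def)
    then show "submonoid (pos (trunc n K) i) (chain (trunc n K) i)"
      by (auto simp: submonoid_def carrier one mult pos_closed)
    show "diff (trunc n K) (Suc i) \<in> hom (chain (trunc n K) (Suc i)) (chain (trunc n K) i)"
      by (auto simp: hom_def carrier mult diff_trunc diff_closed closed diff_mult)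
    show "diff (trunc n K) (Suc i) (diff (trunc n K) (Suc (Suc i)) x) = \<one>\<^bsub>chain (trunc n K) i\<^esub>"
      if "x \<in> carrier (chain (trunc n K) (Suc (Suc i)))" for x
      using that by (auto simp: carrier one diff_trunc diff_closed diff_diff)
  next
    show "aug (trunc n K) \<in> hom (chain (trunc n K) 0) integer_group"
      using hom_mult[OF aug_hom] by (auto simp: hom_def carrier mult aug_trunc closed)
    show "aug (trunc n K) (diff (trunc n K) 1 x) = 0" if "x \<in> carrier (chain (trunc n K) 1)" for x
      using that by (auto simp: carrier diff_trunc[where i = 0, simplified] aug_trunc
          aug_diff[simplified] diff_closed[where i = 0, simplified])
  qed
qed

end

end

theory Submission
  imports Defs
begin

text \<open>
  Let \<open>K\<close> be a strong Steiner complex with basis \<open>B\<close> and \<open>L\<close> an augmented directed complex.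
  The point is that the cells of \<open>nu K\<close> are composites of atoms and identities, so that functors out of \<open>nu K\<close>
  are determined by the highest entries of the images of the atoms.

  A basis element \<open>b\<close> of degree \<open>i\<close> gives an \<open>i\<close>-cell \<open>\<langle>b\<rangle>\<close> whose highest entry is \<open>b\<close>. Applying \<open>nu f\<close>
  to it shows \<open>f b\<close>, so \<open>nu\<close> is faithful. For fullness, take a functor \<open>F\<close> and let
  \<open>f\<^sub>i\<close> be the linear map which sends \<open>b\<close> to the highest entry of \<open>F \<langle>b\<rangle>\<close>. The whole proof reduces
  to the claim that the highest entry of \<open>F x\<close> is \<open>f\<^sub>i x\<^sub>i\<close> for every \<open>i\<close>-cell \<open>x\<close> with highest
  entry \<open>x\<^sub>i\<close> (\<open>top_entry_linear\<close>): the lower entries of \<open>x\<close> are the highest entries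
  of its sources and targets, hence \<open>F\<close> is \<open>f\<close> entrywise, and evaluating \<open>F\<close> on the atoms shows
  that \<open>f\<close> commutes with the differentials and the augmentations.

  Taking highest entries turns every composition \<open>*\<^sub>k\<close> with \<open>k < i\<close> into a sum and every identity
  into zero. So it suffices to cut \<open>x\<close> into atoms and cells with zero highest entry. This is where
  the order \<open>\<le>\<^sub>\<nat>\<close> comes in. Suppose that the entries of \<open>x\<close> in degrees
  above \<open>k\<close> are a sum of several blocks (atoms, of possibly different dimensions). A block \<open>s\<close> can be
  split off as the right-hand factor of a composition \<open>*\<^sub>k\<close>, that is, performed first, as soon as
  what its differential consumes in degree \<open>k\<close> is already contained in \<open>x\<^sup>0\<^sub>k\<close>. This holds if no
  other block produces anything that \<open>s\<close> consumes (\<open>cell_split\<close>). If another block \<open>t\<close>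
  produces a basis element \<open>c\<close> consumed by \<open>s\<close> then \<open>t \<le>\<^sub>\<nat> c \<le>\<^sub>\<nat> s\<close>
  (\<open>atom_boundary_le\<close>), so a block that is minimal for this partial order can always be
  performed first. The cutting is organised in two inductions: \<open>top_entry_linear\<close> separates the
  basis elements of the highest entry, and \<open>top_entry_of_single_basis_element\<close> strips from a cell
  with highest entry \<open>b\<close> everything that does not belong to \<open>\<langle>b\<rangle>\<close>, degree by degree downwards. Nothing
  can be left over in degree 0, since the augmentation of both cells is 1.

  For a truncation, let \<open>p\<close> be the projection from \<open>K\<close> to \<open>trunc n K\<close>. Every cell of
  \<open>nu (trunc n K)\<close> lifts to a cell of \<open>nu K\<close> (\<open>trunc_proj_nu_surj\<close>). So if \<open>G\<close> is a functor on
  \<open>nu (trunc n K)\<close>, then \<open>G \<circ> nu p = nu g\<close> for a unique \<open>g\<close> on \<open>K\<close>, and it remains to factor \<open>g\<close>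
  through \<open>p\<close>. In degrees above \<open>n\<close> the cells of the truncation are identities, hence \<open>g\<close>
  vanishes there, and \<open>g\<^sub>n d = d g\<^sub>n\<^sub>+\<^sub>1 = 0\<close> shows that \<open>g\<^sub>n\<close> kills the boundaries.

  As these two results are about arbitrary \<open>L\<close>, they apply to complexes and to their truncations
  alike.
\<close>

section \<open>Coordinates with respect to a basis\<close>

text \<open>
  The universal property of a basis. Additivity of the extension is checked over the union of the
  two supports, where the coefficients of the sum are the sums of the coefficients.
\<close>

lemma (in comm_group) hom_from_int_basis:
  assumes basis: "int_basis G B" and H: "comm_group H" and g: "g \<in> B \<rightarrow> carrier H"
  obtains h where "h \<in> hom G H" "\<And>b. b \<in> B \<Longrightarrow> h b = g b"
proof -
  interpret H: comm_group H by (rule H)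
  let ?c = "coeffs G B"
  define h where
    "h x = finprod H (\<lambda>b. g b [^]\<^bsub>H\<^esub> Poly_Mapping.lookup (?c x) b) (Poly_Mapping.keys (?c x))" for x
  have h_eq: "h x = finprod H (\<lambda>b. g b [^]\<^bsub>H\<^esub> Poly_Mapping.lookup (?c x) b) S"
    if "Poly_Mapping.keys (?c x) \<subseteq> S" "finite S" "S \<subseteq> B" for x S
    unfolding h_def using that g
    by (intro H.finprod_mono_neutral_cong_left) (auto simp: in_keys_iff Pi_iff)
  have BG: "B \<subseteq> carrier G" using basis by (simp add: int_basis_def)
  have h_mult: "h (x \<otimes> y) = h x \<otimes>\<^bsub>H\<^esub> h y" and h_closed: "h x \<in> carrier H"
    if xy: "x \<in> carrier G" "y \<in> carrier G" for x y
  proof -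
    note x = int_basis_coeffs[OF basis xy(1)] and y = int_basis_coeffs[OF basis xy(2)]
    have k: "Poly_Mapping.keys (?c x + ?c y) \<subseteq> B" using x(1) y(1) keys_add[of "?c x" "?c y"] by blast
    have xy_eq: "x \<otimes> y = lincomb G (?c x + ?c y)"
      using lincomb_add[of "?c x" "?c y"] x y BG by simp
    have c: "?c (x \<otimes> y) = ?c x + ?c y"
      unfolding xy_eq by (rule coeffs_lincomb[OF basis k])
    define S where "S = Poly_Mapping.keys (?c x) \<union> Poly_Mapping.keys (?c y)"
    have S: "finite S" "S \<subseteq> B" "Poly_Mapping.keys (?c x) \<subseteq> S" "Poly_Mapping.keys (?c y) \<subseteq> S"
      "Poly_Mapping.keys (?c (x \<otimes> y)) \<subseteq> S"
      using x(1) y(1) keys_add[of "?c x" "?c y"] by (auto simp: S_def c)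
    have "h (x \<otimes> y) = finprod H (\<lambda>b. g b [^]\<^bsub>H\<^esub> Poly_Mapping.lookup (?c x) b \<otimes>\<^bsub>H\<^esub>
        g b [^]\<^bsub>H\<^esub> Poly_Mapping.lookup (?c y) b) S"
      unfolding h_eq[OF S(5,1,2)] using S(2) g
      by (intro H.finprod_cong') (auto simp: c lookup_add H.int_pow_mult Pi_iff)
    also have "\<dots> = h x \<otimes>\<^bsub>H\<^esub> h y"
      unfolding h_eq[OF S(3,1,2)] h_eq[OF S(4,1,2)] using S(2) g
      by (intro H.finprod_multf) (auto simp: Pi_iff)
    finally show "h (x \<otimes> y) = h x \<otimes>\<^bsub>H\<^esub> h y" .
    show "h x \<in> carrier H"
      unfolding h_def using x(1) g by (intro H.finprod_closed) (auto simp: Pi_iff)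
  qed
  show thesis
  proof
    show "h \<in> hom G H" using h_mult h_closed by (auto simp: hom_def)
    fix b assume b: "b \<in> B"
    then have bG: "b \<in> carrier G" using BG by auto
    have "?c b = ?c (lincomb G (Poly_Mapping.single b 1))"
      using bG by (simp add: lincomb_single)
    also have "\<dots> = Poly_Mapping.single b 1"
      using b by (intro coeffs_lincomb[OF basis]) simp
    finally have "?c b = Poly_Mapping.single b 1" .
    then have "h b = g b [^]\<^bsub>H\<^esub> (1::int)"
      using b g by (subst h_eq[of b "{b}"]) (auto simp: Pi_iff)
    then show "h b = g b" using b g by (auto simp: Pi_iff)
  qed
qed

locale based_adc = adc K for K :: "'a adc_data" +
  fixes B :: "nat \<Rightarrow> 'a set"
  assumes basis: "adc_basis K B"
begin

definition coeff :: "nat \<Rightarrow> 'a \<Rightarrow> 'a \<Rightarrow> int" where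
  "coeff i x b = Poly_Mapping.lookup (coeffs (chain K i) (B i) x) b"

text \<open>The sum of the coefficients: on positive chains this counts basis elements with
  multiplicity and serves as an induction measure.\<close>

definition weight :: "nat \<Rightarrow> 'a \<Rightarrow> int" where
  "weight i x = (\<Sum>b | coeff i x b \<noteq> 0. coeff i x b)"

lemma int_basis: "int_basis (chain K i) (B i)"
  using basis by (simp add: adc_basis_def)

lemma group_chain [simp]: "group (chain K i)"
  using comm_group_chain comm_group_def by blast

lemma mult_closed [simp]:
  "x \<in> carrier (chain K i) \<Longrightarrow> y \<in> carrier (chain K i) \<Longrightarrow> x \<otimes>\<^bsub>chain K i\<^esub> y \<in> carrier (chain K i)"
  by (simp add: group.is_monoid monoid.m_closed)

lemma inv_closed [simp]: "x \<in> carrier (chain K i) \<Longrightarrow> inv\<^bsub>chain K i\<^esub> x \<in> carrier (chain K i)"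
  by (simp add: group.inv_closed)

lemma one_closed [simp]: "\<one>\<^bsub>chain K i\<^esub> \<in> carrier (chain K i)"
  by (simp add: group.is_monoid monoid.one_closed)

lemma basis_carrier: "b \<in> B i \<Longrightarrow> b \<in> carrier (chain K i)"
  using int_basis[of i] by (auto simp: int_basis_def)

lemma coeff_mult [simp]:
  assumes "x \<in> carrier (chain K i)" "y \<in> carrier (chain K i)"
  shows "coeff i (x \<otimes>\<^bsub>chain K i\<^esub> y) b = coeff i x b + coeff i y b"
proof -
  interpret comm_group "chain K i" by (rule comm_group_chain)
  let ?c = "coeffs (chain K i) (B i)"
  note x = int_basis_coeffs[OF int_basis assms(1)] and y = int_basis_coeffs[OF int_basis assms(2)]
  have k: "Poly_Mapping.keys (?c x + ?c y) \<subseteq> B i"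
    using x(1) y(1) keys_add[of "?c x" "?c y"] by blast
  have eq: "x \<otimes>\<^bsub>chain K i\<^esub> y = lincomb (chain K i) (?c x + ?c y)"
    using lincomb_add[of "?c x" "?c y"] x y basis_carrier by (simp add: subset_iff)
  show ?thesis
    unfolding coeff_def eq coeffs_lincomb[OF int_basis k] by (simp add: lookup_add)
qed

lemma coeff_one [simp]: "coeff i \<one>\<^bsub>chain K i\<^esub> b = 0"
  using coeff_mult[OF one_closed one_closed, of i b] group.is_monoid[OF group_chain]
  by (simp add: monoid.l_one)

lemma coeff_inv [simp]:
  assumes "x \<in> carrier (chain K i)"
  shows "coeff i (inv\<^bsub>chain K i\<^esub> x) b = - coeff i x b"
  using coeff_mult[OF assms inv_closed[OF assms], of b] assms by (simp add: group.r_inv)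

lemma coeff_eqI:
  assumes "x \<in> carrier (chain K i)" "y \<in> carrier (chain K i)" "\<And>b. coeff i x b = coeff i y b"
  shows "x = y"
proof -
  interpret comm_group "chain K i" by (rule comm_group_chain)
  have "coeffs (chain K i) (B i) x = coeffs (chain K i) (B i) y"
    by (rule poly_mapping_eqI) (rule assms(3)[unfolded coeff_def])
  then show ?thesis
    by (metis int_basis_coeffs(2)[OF int_basis] assms(1,2))
qed

lemma coeff_basis [simp]:
  assumes "b \<in> B i"
  shows "coeff i b c = (if c = b then 1 else 0)"
proof -
  interpret comm_group "chain K i" by (rule comm_group_chain)
  have "b = lincomb (chain K i) (Poly_Mapping.single b 1)"
    using basis_carrier[OF assms] by (simp add: lincomb_single)
  then have "coeffs (chain K i) (B i) b = Poly_Mapping.single b 1"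
    using coeffs_lincomb[OF int_basis, of "Poly_Mapping.single b 1"] assms by simp
  then show ?thesis by (simp add: coeff_def lookup_single when_def)
qed

lemma coeff_nonzero_basis:
  assumes "x \<in> carrier (chain K i)" "coeff i x b \<noteq> 0"
  shows "b \<in> B i"
proof -
  interpret comm_group "chain K i" by (rule comm_group_chain)
  show ?thesis
    using int_basis_coeffs(1)[OF int_basis assms(1)] assms(2) by (auto simp: coeff_def in_keys_iff)
qed

lemma finite_coeff [simp]: "finite {b. coeff i x b \<noteq> 0}"
  by (simp add: coeff_def)

lemma pos_eq: "pos K i = {x \<in> carrier (chain K i). \<forall>b. 0 \<le> coeff i x b}"
proof -
  interpret comm_group "chain K i" by (rule comm_group_chain)
  have BG: "B i \<subseteq> carrier (chain K i)" using basis_carrier by auto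
  have "pos K i = (\<lambda>M. submonoid M (chain K i)) hull B i"
    using basis by (simp add: adc_basis_def)
  then have P: "pos K i =
      {lincomb (chain K i) c |c. Poly_Mapping.keys c \<subseteq> B i \<and> (\<forall>b. 0 \<le> Poly_Mapping.lookup c b)}"
    by (simp add: submonoid_hull_eq[OF BG])
  show ?thesis
  proof (intro equalityI subsetI)
    fix x assume "x \<in> pos K i"
    then obtain c where c: "x = lincomb (chain K i) c" "Poly_Mapping.keys c \<subseteq> B i"
      "\<forall>b. 0 \<le> Poly_Mapping.lookup c b" unfolding P by auto
    then show "x \<in> {x \<in> carrier (chain K i). \<forall>b. 0 \<le> coeff i x b}"
      using BG by (simp add: coeff_def coeffs_lincomb[OF int_basis] lincomb_closed)
  next
    fix x assume x: "x \<in> {x \<in> carrier (chain K i). \<forall>b. 0 \<le> coeff i x b}"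
    then have "x = lincomb (chain K i) (coeffs (chain K i) (B i) x)"
      "Poly_Mapping.keys (coeffs (chain K i) (B i) x) \<subseteq> B i"
      using int_basis_coeffs[OF int_basis] by auto
    with x show "x \<in> pos K i" unfolding P coeff_def by blast
  qed
qed

lemma one_pos [simp]: "\<one>\<^bsub>chain K i\<^esub> \<in> pos K i" by (simp add: pos_eq)

lemma mult_pos [simp]: "x \<in> pos K i \<Longrightarrow> y \<in> pos K i \<Longrightarrow> x \<otimes>\<^bsub>chain K i\<^esub> y \<in> pos K i"
  by (simp add: pos_eq)

lemma basis_pos: "b \<in> B i \<Longrightarrow> b \<in> pos K i"
  by (simp add: pos_eq basis_carrier)

lemma pos_remove:
  assumes "x \<in> pos K i" "coeff i x b \<noteq> 0"
  shows "x \<otimes>\<^bsub>chain K i\<^esub> inv\<^bsub>chain K i\<^esub> b \<in> pos K i"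
proof -
  have b: "b \<in> B i" by (rule coeff_nonzero_basis[OF pos_closed[OF assms(1)] assms(2)])
  have "0 \<le> coeff i x c" for c using assms(1) by (simp add: pos_eq)
  moreover have "1 \<le> coeff i x b" using calculation[of b] assms(2) by linarith
  ultimately show ?thesis
    using b pos_closed[OF assms(1)] by (simp add: pos_eq basis_carrier)
qed

text \<open>The hull only gives minimality among submonoids. The set of those \<open>y\<close> for which adding \<open>y\<close>
  preserves \<open>P\<close> is a submonoid, which reduces the rule to that.\<close>

lemma pos_induct [consumes 1, case_names one mult]:
  assumes x: "x \<in> pos K i" and one: "P \<one>\<^bsub>chain K i\<^esub>"
    and mult: "\<And>x b. x \<in> pos K i \<Longrightarrow> b \<in> B i \<Longrightarrow> P x \<Longrightarrow> P (x \<otimes>\<^bsub>chain K i\<^esub> b)"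
  shows "P x"
proof -
  interpret comm_group "chain K i" by (rule comm_group_chain)
  let ?M = "{y \<in> pos K i. \<forall>x\<in>pos K i. P x \<longrightarrow> P (x \<otimes>\<^bsub>chain K i\<^esub> y)}"
  have "submonoid ?M (chain K i)"
    by (rule submonoid.intro) (auto simp: pos_closed simp flip: m_assoc)
  moreover have "B i \<subseteq> ?M" using mult basis_pos by auto
  ultimately have "(\<lambda>M. submonoid M (chain K i)) hull B i \<subseteq> ?M" by (intro hull_minimal)
  moreover have "pos K i = (\<lambda>M. submonoid M (chain K i)) hull B i"
    using basis by (simp add: adc_basis_def)
  ultimately have "P (\<one>\<^bsub>chain K i\<^esub> \<otimes>\<^bsub>chain K i\<^esub> x)" using x one by fastforce
  then show ?thesis using pos_closed[OF x] by simp
qed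

lemma weight_mult:
  assumes "x \<in> carrier (chain K i)" "y \<in> carrier (chain K i)"
  shows "weight i (x \<otimes>\<^bsub>chain K i\<^esub> y) = weight i x + weight i y"
proof -
  let ?S = "{b. coeff i x b \<noteq> 0} \<union> {b. coeff i y b \<noteq> 0}"
  have w: "weight i z = sum (coeff i z) ?S" if "{b. coeff i z b \<noteq> 0} \<subseteq> ?S" for z
    unfolding weight_def using that by (intro sum.mono_neutral_left) auto
  have "{b. coeff i (x \<otimes>\<^bsub>chain K i\<^esub> y) b \<noteq> 0} \<subseteq> ?S" using assms by auto
  from w[OF this] w[of x] w[of y] show ?thesis
    using assms by (simp add: sum.distrib)
qed

lemma weight_basis:
  assumes "b \<in> B i"
  shows "weight i b = 1"
proof -
  have "{c. coeff i b c \<noteq> 0} = {b}" using assms by auto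
  then show ?thesis using assms unfolding weight_def by simp
qed

lemma weight_one: "weight i \<one>\<^bsub>chain K i\<^esub> = 0"
  by (simp add: weight_def)

lemma weight_nonneg: "x \<in> pos K i \<Longrightarrow> 0 \<le> weight i x"
  by (auto simp: weight_def pos_eq intro: sum_nonneg)

lemma weight_zero:
  assumes x: "x \<in> pos K i" and w: "weight i x = 0"
  shows "x = \<one>\<^bsub>chain K i\<^esub>"
proof (rule coeff_eqI)
  fix b
  have "\<forall>b\<in>{b. coeff i x b \<noteq> 0}. coeff i x b = 0"
    using w x sum_nonneg_eq_0_iff[OF finite_coeff, of i x "coeff i x"]
    unfolding weight_def pos_eq by blast
  then have "coeff i x b = 0" by blast
  then show "coeff i x b = coeff i \<one>\<^bsub>chain K i\<^esub> b" by simp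
qed (rule pos_closed[OF x], rule one_closed)

lemma weight_remove:
  assumes "x \<in> pos K i" "coeff i x b \<noteq> 0"
  shows "weight i (x \<otimes>\<^bsub>chain K i\<^esub> inv\<^bsub>chain K i\<^esub> b) = weight i x - 1"
proof -
  have b: "b \<in> B i" by (rule coeff_nonzero_basis[OF pos_closed[OF assms(1)] assms(2)])
  have c: "x \<in> carrier (chain K i)" "b \<in> carrier (chain K i)"
    using assms(1) b by (auto simp: pos_closed basis_carrier)
  have "(x \<otimes>\<^bsub>chain K i\<^esub> inv\<^bsub>chain K i\<^esub> b) \<otimes>\<^bsub>chain K i\<^esub> b = x"
    using c by (intro coeff_eqI) auto
  then show ?thesis
    using weight_mult[of "x \<otimes>\<^bsub>chain K i\<^esub> inv\<^bsub>chain K i\<^esub> b" i b] c b by (simp add: weight_basis)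
qed

lemma hom_eqI:
  assumes H: "group H" and h: "h \<in> hom (chain K i) H" and h': "h' \<in> hom (chain K i) H"
    and eq: "\<And>b. b \<in> B i \<Longrightarrow> h b = h' b" and x: "x \<in> carrier (chain K i)"
  shows "h x = h' x"
proof -
  interpret h: group_hom "chain K i" H h
    by (simp add: group_hom_def group_hom_axioms_def H h)
  interpret h': group_hom "chain K i" H h'
    by (simp add: group_hom_def group_hom_axioms_def H h')
  have pos: "h y = h' y" if "y \<in> pos K i" for y
    using that
    by (induction rule: pos_induct) (auto simp: pos_closed basis_carrier eq)
  obtain p m where "is_decomposition K B i x p m"
    using pos_neg_parts(1)[OF basis x] by blast
  then have "p \<in> pos K i" "m \<in> pos K i" "x = p \<otimes>\<^bsub>chain K i\<^esub> inv\<^bsub>chain K i\<^esub> m"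
    by (auto simp: is_decomposition_def)
  then show ?thesis by (simp add: pos pos_closed)
qed

lemma diff_inv:
  "x \<in> carrier (chain K (Suc i)) \<Longrightarrow>
    diff K (Suc i) (inv\<^bsub>chain K (Suc i)\<^esub> x) = inv\<^bsub>chain K i\<^esub> diff K (Suc i) x"
  by (intro group_hom.hom_inv) (simp_all add: group_hom_def group_hom_axioms_def diff_hom)

text \<open>
  If something is produced (\<open>s = 1\<close>) or consumed (\<open>s = -1\<close>) by a positive chain, then one of its
  basis elements does so: coefficients of the same sign are needed for the total to have that sign,
  and supports of positive chains can only grow under addition.
\<close>

lemma coeff_diff_support:
  fixes s :: int
  assumes "u \<in> pos K (Suc k)" "0 < s * coeff k (diff K (Suc k) u) c"
  shows "\<exists>a. coeff (Suc k) u a \<noteq> 0 \<and> 0 < s * coeff k (diff K (Suc k) a) c"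
  using assms
proof (induction rule: pos_induct)
  case one
  then show ?case by (simp add: diff_one)
next
  case (mult u b)
  have nonneg: "0 \<le> coeff (Suc k) u a" for a using mult(1) by (simp add: pos_eq)
  have uc: "u \<in> carrier (chain K (Suc k))" "b \<in> carrier (chain K (Suc k))"
    using mult by (simp_all add: pos_closed basis_carrier)
  with mult.prems have "0 < s * coeff k (diff K (Suc k) u) c \<or> 0 < s * coeff k (diff K (Suc k) b) c"
    by (auto simp: diff_mult diff_closed distrib_left)
  moreover have "coeff (Suc k) (u \<otimes>\<^bsub>chain K (Suc k)\<^esub> b) a \<noteq> 0" if "coeff (Suc k) u a \<noteq> 0" for a
    using that nonneg[of a] uc mult(2) by auto
  moreover have "coeff (Suc k) (u \<otimes>\<^bsub>chain K (Suc k)\<^esub> b) b \<noteq> 0"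
    using nonneg[of b] uc mult(2) by simp
  ultimately show ?case using mult.IH by blast
qed

end

section \<open>Splitting cells\<close>

definition to_matrix :: "nat \<Rightarrow> (bool \<Rightarrow> nat \<Rightarrow> 'a) \<Rightarrow> 'a matrix" where
  "to_matrix i m = map (\<lambda>k. (m False k, m True k)) [0..<Suc i]"

lemma length_to_matrix [simp]: "length (to_matrix i m) = Suc i"
  by (simp add: to_matrix_def)

lemma entry_to_matrix [simp]: "k \<le> i \<Longrightarrow> entry (to_matrix i m) \<epsilon> k = m \<epsilon> k"
  by (simp add: to_matrix_def entry_def del: upt_Suc)

lemma to_matrix_cell:
  assumes "\<And>\<epsilon> k. k \<le> i \<Longrightarrow> m \<epsilon> k \<in> pos K k"
    and "\<And>\<epsilon> k. k < i \<Longrightarrow>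
      diff K (Suc k) (m \<epsilon> (Suc k)) = m True k \<otimes>\<^bsub>chain K k\<^esub> inv\<^bsub>chain K k\<^esub> m False k"
    and "\<And>\<epsilon>. aug K (m \<epsilon> 0) = 1" and "m False i = m True i"
  shows "to_matrix i m \<in> nu_cells K i"
  using assms by (simp add: nu_cells_def)

text \<open>A zero in the highest column forces the two entries below it to agree, as their difference
  is its boundary.\<close>

lemma (in adc) cell_with_trivial_top:
  assumes x: "x \<in> nu_cells K (Suc i)" and top: "entry x True (Suc i) = \<one>\<^bsub>chain K (Suc i)\<^esub>"
  shows "x = nu_ident K i (nu_bound True i x)" "nu_bound True i x \<in> nu_cells K i"
proof -
  interpret comm_group "chain K i" by (rule comm_group_chain)
  note xD = nu_cellD[OF x]
  have "entry x True i \<otimes>\<^bsub>chain K i\<^esub> inv\<^bsub>chain K i\<^esub> entry x False i = \<one>\<^bsub>chain K i\<^esub>"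
    using xD(4)[of i True] top by (simp add: diff_one)
  then have eq: "entry x False i = entry x True i"
    using xD(3)[of i True] xD(3)[of i False] by (metis inv_equality inv_inv inv_closed le_SucI le_refl)
  show b: "nu_bound True i x \<in> nu_cells K i"
    by (rule nu_bound_cell[OF x]) simp
  show "x = nu_ident K i (nu_bound True i x)"
  proof (rule matrix_eqI)
    show "length x = length (nu_ident K i (nu_bound True i x))"
      by (simp add: length_nu_ident length_nu_bound xD(1))
    fix \<epsilon> k assume "k < length x"
    then have "k \<le> Suc i" by (simp add: xD(1))
    moreover have "entry x \<epsilon> (Suc i) = \<one>\<^bsub>chain K (Suc i)\<^esub>"
      using nu_cell_top[OF x] top by simp
    moreover have "entry x \<epsilon> i = entry x True i" using eq by (cases \<epsilon>) simp_all
    ultimately show "entry x \<epsilon> k = entry (nu_ident K i (nu_bound True i x)) \<epsilon> k"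
      by (auto simp: entry_nu_ident length_nu_bound entry_nu_bound xD(1) le_Suc_eq)
  qed
qed

context based_adc
begin

lemma coeff_cell_diff:
  assumes "x \<in> nu_cells K i" "k < i"
  shows "coeff k (diff K (Suc k) (entry x \<epsilon> (Suc k))) c = coeff k (entry x True k) c - coeff k (entry x False k) c"
  using nu_cellD(4)[OF assms] nu_cellD(3)[OF assms(1), of k] assms(2) by simp

text \<open>
  The columns of \<open>x\<close> above \<open>k\<close> are written as a sum \<open>q + p\<close>, and \<open>p\<close> is to be performed before \<open>q\<close>.
  The middle \<open>k\<close>-cell of the composition then has to be \<open>v = x\<^sup>0\<^sub>k + d p\<^sub>k\<^sub>+\<^sub>1\<close>, and the only
  obstruction is that \<open>v\<close> be positive. Where \<open>d p\<^sub>k\<^sub>+\<^sub>1\<close> has a negative coefficient,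
  the assumption \<open>first\<close> says that \<open>q\<close> contributes nothing positive to
  \<open>x\<^sup>1\<^sub>k - x\<^sup>0\<^sub>k = d q\<^sub>k\<^sub>+\<^sub>1 + d p\<^sub>k\<^sub>+\<^sub>1\<close>; hence \<open>v \<ge> x\<^sup>1\<^sub>k \<ge> 0\<close> there, and elsewhere
  \<open>v \<ge> x\<^sup>0\<^sub>k \<ge> 0\<close>.
\<close>

lemma cell_split:
  assumes x: "x \<in> nu_cells K i" and k: "k < i"
    and p: "\<And>\<epsilon> l. k < l \<Longrightarrow> l \<le> i \<Longrightarrow> p \<epsilon> l \<in> pos K l"
    and q: "\<And>\<epsilon> l. k < l \<Longrightarrow> l \<le> i \<Longrightarrow> q \<epsilon> l \<in> pos K l"
    and x_eq: "\<And>\<epsilon> l. k < l \<Longrightarrow> l \<le> i \<Longrightarrow> entry x \<epsilon> l = q \<epsilon> l \<otimes>\<^bsub>chain K l\<^esub> p \<epsilon> l"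
    and p_diff: "\<And>\<epsilon> l. k < l \<Longrightarrow> l < i \<Longrightarrow>
      diff K (Suc l) (p \<epsilon> (Suc l)) = p True l \<otimes>\<^bsub>chain K l\<^esub> inv\<^bsub>chain K l\<^esub> p False l"
    and p_top: "p False i = p True i"
    and p_bottom: "\<And>\<epsilon>. diff K (Suc k) (p \<epsilon> (Suc k)) = diff K (Suc k) (p True (Suc k))"
    and first: "\<And>c. coeff k (diff K (Suc k) (p True (Suc k))) c < 0 \<Longrightarrow>
      coeff k (diff K (Suc k) (q True (Suc k))) c \<le> 0"
  obtains y z where "y \<in> nu_cells K i" "z \<in> nu_cells K i"
    "nu_bound False k y = nu_bound True k z" "x = nu_comp K i k y z"
    "\<And>\<epsilon> l. k < l \<Longrightarrow> l \<le> i \<Longrightarrow> entry y \<epsilon> l = q \<epsilon> l"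
    "\<And>\<epsilon> l. k < l \<Longrightarrow> l \<le> i \<Longrightarrow> entry z \<epsilon> l = p \<epsilon> l"
proof -
  note xD = nu_cellD[OF x]
  let ?d = "diff K (Suc k) (p True (Suc k))"
  define v where "v = entry x False k \<otimes>\<^bsub>chain K k\<^esub> ?d"
  define z where "z = to_matrix i (\<lambda>\<epsilon> l.
    if l < k then entry x \<epsilon> l else if l = k then (if \<epsilon> then v else entry x False k) else p \<epsilon> l)"
  define y where "y = to_matrix i (\<lambda>\<epsilon> l.
    if l < k then entry x \<epsilon> l else if l = k then (if \<epsilon> then entry x True k else v) else q \<epsilon> l)"
  have carrier: "p \<epsilon> l \<in> carrier (chain K l)" "q \<epsilon> l \<in> carrier (chain K l)"
    if "k < l" "l \<le> i" for \<epsilon> l using p q that by (simp_all add: pos_closed)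
  have d: "?d \<in> carrier (chain K k)" using k carrier by (simp add: diff_closed)
  have xk: "entry x \<epsilon> k \<in> carrier (chain K k)" for \<epsilon> using xD(3)[of k] k by simp
  have v: "v \<in> carrier (chain K k)" using d xk by (simp add: v_def)
  have dx: "diff K (Suc k) (entry x \<epsilon> (Suc k)) =
      diff K (Suc k) (q \<epsilon> (Suc k)) \<otimes>\<^bsub>chain K k\<^esub> ?d" for \<epsilon>
    using k carrier p_bottom[of \<epsilon>] by (simp add: x_eq diff_mult)
  have cdx: "coeff k (diff K (Suc k) (q \<epsilon> (Suc k))) c + coeff k ?d c =
      coeff k (entry x True k) c - coeff k (entry x False k) c" for c \<epsilon>
    using coeff_cell_diff[OF x k, of \<epsilon> c] k carrier d by (simp add: dx diff_closed)
  have v_pos: "v \<in> pos K k"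
  proof -
    have "0 \<le> coeff k v c" for c
    proof -
      have "0 \<le> coeff k (entry x \<epsilon> k) c" for \<epsilon> using xD(2)[of k \<epsilon>] k by (simp add: pos_eq)
      from this[of True] this[of False] show ?thesis
        using first[of c] cdx[of True c] d xk by (cases "coeff k ?d c < 0") (auto simp: v_def)
    qed
    then show ?thesis using v by (simp add: pos_eq)
  qed
  have dv: "diff K k v = diff K k (entry x False k)" if "0 < k"
  proof -
    obtain j where j: "k = Suc j" using \<open>0 < k\<close> by (cases k) auto
    have "diff K (Suc j) ?d = \<one>\<^bsub>chain K j\<^esub>"
      using diff_diff[of "p True (Suc (Suc j))" j] carrier k by (simp add: j)
    moreover have "monoid (chain K j)" by (simp add: group.is_monoid)
    ultimately show ?thesis
      using d xk by (simp add: v_def j diff_mult diff_closed monoid.r_one)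
  qed
  have aug_v: "aug K v = 1" if "k = 0"
    using that d xk xD(5)[of False] aug_diff[of "p True (Suc 0)"] carrier[of 1] k hom_mult[OF aug_hom]
    by (simp add: v_def)
  have z_cell: "z \<in> nu_cells K i"
    unfolding z_def
  proof (rule to_matrix_cell, goal_cases)
    case (1 \<epsilon> l)
    then show ?case using p v_pos xD(2) by auto
  next
    case (2 \<epsilon> l)
    consider "Suc l < k" | "Suc l = k" | "l = k" | "k < l" by linarith
    then show ?case
    proof cases
      case 2
      then show ?thesis using dv xD(4)[of l] k by auto
    next
      case 3
      then have "diff K (Suc l) (p \<epsilon> (Suc l)) = ?d" using p_bottom by simp
      moreover have "?d = v \<otimes>\<^bsub>chain K k\<^esub> inv\<^bsub>chain K k\<^esub> entry x False k"
        unfolding v_def by (rule coeff_eqI[where i = k]) (simp_all add: d xk)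
      ultimately show ?thesis using 3 by simp
    qed (use \<open>l < i\<close> xD(4) p_diff in auto)
  next
    case (3 \<epsilon>)
    then show ?case using xD(5) aug_v by auto
  next
    case 4
    then show ?case using k p_top by simp
  qed
  have y_cell: "y \<in> nu_cells K i"
    unfolding y_def
  proof (rule to_matrix_cell, goal_cases)
    case (1 \<epsilon> l)
    then show ?case using q v_pos xD(2) by auto
  next
    case (2 \<epsilon> l)
    consider "Suc l < k" | "Suc l = k" | "l = k" | "k < l" by linarith
    then show ?case
    proof cases
      case 2
      then show ?thesis using dv xD(4)[of l] k by auto
    next
      case 3
      have "diff K (Suc k) (q \<epsilon> (Suc k)) = entry x True k \<otimes>\<^bsub>chain K k\<^esub> inv\<^bsub>chain K k\<^esub> v"
      proof (rule coeff_eqI)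
        show "diff K (Suc k) (q \<epsilon> (Suc k)) \<in> carrier (chain K k)"
          using k carrier by (simp add: diff_closed)
        show "coeff k (diff K (Suc k) (q \<epsilon> (Suc k))) c =
            coeff k (entry x True k \<otimes>\<^bsub>chain K k\<^esub> inv\<^bsub>chain K k\<^esub> v) c" for c
          using cdx[of \<epsilon> c] xk v d by (simp add: v_def)
      qed (use xk v in simp)
      then show ?thesis using 3 by simp
    next
      case 4
      have "diff K (Suc l) (q \<epsilon> (Suc l)) = q True l \<otimes>\<^bsub>chain K l\<^esub> inv\<^bsub>chain K l\<^esub> q False l"
      proof (rule coeff_eqI)
        show "diff K (Suc l) (q \<epsilon> (Suc l)) \<in> carrier (chain K l)"
          using 4 \<open>l < i\<close> carrier by (simp add: diff_closed)
        show "coeff l (diff K (Suc l) (q \<epsilon> (Suc l))) c =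
            coeff l (q True l \<otimes>\<^bsub>chain K l\<^esub> inv\<^bsub>chain K l\<^esub> q False l) c" for c
        proof -
          have "diff K (Suc l) (entry x \<epsilon> (Suc l)) = diff K (Suc l) (q \<epsilon> (Suc l)) \<otimes>\<^bsub>chain K l\<^esub>
              (p True l \<otimes>\<^bsub>chain K l\<^esub> inv\<^bsub>chain K l\<^esub> p False l)"
            using 4 \<open>l < i\<close> carrier p_diff by (simp add: x_eq diff_mult)
          then show ?thesis
            using coeff_cell_diff[OF x \<open>l < i\<close>, of \<epsilon> c] 4 \<open>l < i\<close> carrier by (simp add: x_eq diff_closed)
        qed
      qed (use 4 \<open>l < i\<close> carrier in simp)
      then show ?thesis using 4 by simp
    qed (use \<open>l < i\<close> xD(4) in auto)
  next
    case (3 \<epsilon>)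
    then show ?case using xD(5) aug_v by auto
  next
    case 4
    have "q False i = q True i"
    proof (rule coeff_eqI)
      show "coeff i (q False i) c = coeff i (q True i) c" for c
        using xD(6) x_eq[of i] carrier[of i] k p_top by (metis add_right_cancel coeff_mult le_refl)
    qed (use k carrier in simp_all)
    then show ?case using k by simp
  qed
  have yz: "nu_bound False k y = nu_bound True k z"
    using k by (intro matrix_eqI) (auto simp: length_nu_bound entry_nu_bound y_def z_def)
  have "x = nu_comp K i k y z"
    using k by (intro matrix_eqI)
      (auto simp: xD(1) length_nu_comp entry_nu_comp y_def z_def x_eq)
  then show thesis
    using k by (intro that[OF y_cell z_cell yz]) (auto simp: y_def z_def)
qed


section \<open>Atoms\<close>

lemma atom_top [simp]: "atom K B i b \<epsilon> i = b"
  by (simp add: atom_def)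

lemma atom_below:
  assumes "k < i"
  shows "atom K B i b \<epsilon> k =
    (if \<epsilon> then pos_part else neg_part) K B k (diff K (Suc k) (atom K B i b \<epsilon> (Suc k)))"
proof -
  have "i - k = Suc (i - Suc k)" "i - Suc (i - Suc k) = k" "i - (i - Suc k) = Suc k"
    using assms by simp_all
  then show ?thesis by (simp add: atom_def)
qed

lemma parts_pos:
  assumes "x \<in> carrier (chain K k)"
  shows "pos_part K B k x \<in> pos K k" "neg_part K B k x \<in> pos K k"
    "x = pos_part K B k x \<otimes>\<^bsub>chain K k\<^esub> inv\<^bsub>chain K k\<^esub> neg_part K B k x"
  using pos_neg_parts(1)[OF basis assms, of "pos_part K B k x" "neg_part K B k x"]
  by (simp_all add: is_decomposition_def)

lemma atom_pos:
  assumes b: "b \<in> B i" and k: "k \<le> i"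
  shows "atom K B i b \<epsilon> k \<in> pos K k"
  using k
proof (induction k rule: inc_induct)
  case base
  then show ?case using b by (simp add: basis_pos)
next
  case (step k)
  then have "diff K (Suc k) (atom K B i b \<epsilon> (Suc k)) \<in> carrier (chain K k)"
    by (simp add: diff_closed pos_closed)
  from parts_pos(1,2)[OF this] show ?case
    using step by (cases \<epsilon>) (simp_all add: atom_below)
qed

text \<open>
  By definition the two parts of an atom in degree \<open>k\<close> are taken from two boundaries, of
  \<open>\<langle>b\<rangle>\<^sup>0\<close> and of \<open>\<langle>b\<rangle>\<^sup>1\<close> in degree \<open>k + 1\<close>. These coincide because the difference
  of the two chains is itself a boundary.
\<close>

lemma atom_diff:
  assumes b: "b \<in> B i" and k: "k < i"
  shows "diff K (Suc k) (atom K B i b \<epsilon> (Suc k)) =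
    atom K B i b True k \<otimes>\<^bsub>chain K k\<^esub> inv\<^bsub>chain K k\<^esub> atom K B i b False k"
proof -
  let ?a = "atom K B i b"
  have closed: "?a \<epsilon> l \<in> carrier (chain K l)" if "l \<le> i" for \<epsilon> l
    using atom_pos[OF b that] by (rule pos_closed)
  have step_diff: "diff K (Suc l) (?a \<epsilon> (Suc l)) = ?a True l \<otimes>\<^bsub>chain K l\<^esub> inv\<^bsub>chain K l\<^esub> ?a False l"
    if "diff K (Suc l) (?a True (Suc l)) = diff K (Suc l) (?a False (Suc l))" "l < i" for l \<epsilon>
  proof -
    let ?d = "diff K (Suc l) (?a True (Suc l))"
    have "?d \<in> carrier (chain K l)" using that(2) by (simp add: diff_closed closed)
    from parts_pos(3)[OF this]
    have "?d = ?a True l \<otimes>\<^bsub>chain K l\<^esub> inv\<^bsub>chain K l\<^esub> ?a False l"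
      using that by (simp add: atom_below)
    then show ?thesis using that(1) by (cases \<epsilon>) simp_all
  qed
  have "diff K (Suc k) (?a True (Suc k)) = diff K (Suc k) (?a False (Suc k))"
  proof -
    have "0 < l \<Longrightarrow> diff K l (?a True l) = diff K l (?a False l)" if "l \<le> i" for l
      using that
    proof (induction l rule: inc_induct)
      case base
      show ?case by simp
    next
      case (step l)
      then obtain m where m: "l = Suc m" by (cases l) auto
      have c: "?a \<epsilon> l \<in> carrier (chain K (Suc m))" for \<epsilon>
        using closed[of l] step by (simp add: m)
      have "diff K (Suc m) (diff K (Suc l) (?a True (Suc l))) = \<one>\<^bsub>chain K m\<^esub>"
        using closed[of "Suc l"] step by (simp add: m diff_diff)
      then have "diff K (Suc m) (?a True l) \<otimes>\<^bsub>chain K m\<^esub> inv\<^bsub>chain K m\<^esub> diff K (Suc m) (?a False l) = \<one>\<^bsub>chain K m\<^esub>"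
        using step_diff[of l True] step c by (simp add: m diff_mult diff_inv)
      then have "coeff m (diff K (Suc m) (?a True l)) a - coeff m (diff K (Suc m) (?a False l)) a = 0" for a
        using c by (metis coeff_inv coeff_mult coeff_one diff_closed inv_closed uminus_add_conv_diff add.commute)
      then show ?case
        unfolding m using c diff_closed by (intro coeff_eqI) (auto simp: m)
    qed
    from this[of "Suc k"] show ?thesis using k by simp
  qed
  then show ?thesis using k by (rule step_diff)
qed

lemma atom_cell:
  assumes b: "b \<in> B i" and unit: "\<And>\<epsilon>. aug K (atom K B i b \<epsilon> 0) = 1"
  shows "to_matrix i (atom K B i b) \<in> nu_cells K i"
  using atom_pos[OF b] atom_diff[OF b] unit by (intro to_matrix_cell) simp_all

lemma coeff_atom:
  assumes b: "b \<in> B i" and k: "k < i"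
  shows "coeff k (atom K B i b True k) c =
      max 0 (coeff k (diff K (Suc k) (atom K B i b \<epsilon> (Suc k))) c)"
    and "coeff k (atom K B i b False k) c =
      max 0 (- coeff k (diff K (Suc k) (atom K B i b \<epsilon> (Suc k))) c)"
proof -
  have d: "diff K (Suc k) (atom K B i b \<epsilon> (Suc k)) \<in> carrier (chain K k)" for \<epsilon>
    using atom_pos[OF b, of "Suc k"] k by (simp add: diff_closed pos_closed)
  have eq: "diff K (Suc k) (atom K B i b \<epsilon> (Suc k)) = diff K (Suc k) (atom K B i b \<delta> (Suc k))" for \<delta>
    using atom_diff[OF b k] by simp
  show "coeff k (atom K B i b True k) c =
      max 0 (coeff k (diff K (Suc k) (atom K B i b \<epsilon> (Suc k))) c)"
    using pos_neg_parts(2)[OF basis d] by (subst eq[of True]) (simp add: atom_below[OF k] coeff_def)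
  show "coeff k (atom K B i b False k) c =
      max 0 (- coeff k (diff K (Suc k) (atom K B i b \<epsilon> (Suc k))) c)"
    using pos_neg_parts(3)[OF basis d] by (subst eq[of False]) (simp add: atom_below[OF k] coeff_def)
qed


section \<open>Strong loop-freeness\<close>

lemma leN_step_iff:
  assumes a: "a \<in> B (Suc k)"
  shows "((k, c), (Suc k, a)) \<in> leN_step K B \<longleftrightarrow> coeff k (diff K (Suc k) a) c < 0"
    "((Suc k, a), (k, c)) \<in> leN_step K B \<longleftrightarrow> 0 < coeff k (diff K (Suc k) a) c"
proof -
  have d: "diff K (Suc k) a \<in> carrier (chain K k)" using a by (simp add: diff_closed basis_carrier)
  show "((k, c), (Suc k, a)) \<in> leN_step K B \<longleftrightarrow> coeff k (diff K (Suc k) a) c < 0"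
    "((Suc k, a), (k, c)) \<in> leN_step K B \<longleftrightarrow> 0 < coeff k (diff K (Suc k) a) c"
    using a coeff_nonzero_basis[OF d, of c] pos_neg_parts(2,3)[OF basis d, of c]
    by (auto simp: leN_step_def supp_def in_keys_iff coeff_def)
qed

text \<open>
  This extends the generating relation of \<open>\<le>\<^sub>\<nat>\<close> from consecutive degrees to all lower ones.
  What the boundary of an atom consumes in degree \<open>k\<close> is consumed by some basis element of
  \<open>\<langle>b\<rangle>\<^sup>0\<close> in degree \<open>k + 1\<close>, and this one is in turn consumed by the boundary one degree up;
  dually for what is produced.
\<close>

lemma atom_boundary_le:
  assumes b: "b \<in> B i" and k: "k < i"
  shows "coeff k (diff K (Suc k) (atom K B i b True (Suc k))) c < 0 \<Longrightarrow>
      ((k, c), (i, b)) \<in> (leN_step K B)\<^sup>*"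
    and "0 < coeff k (diff K (Suc k) (atom K B i b True (Suc k))) c \<Longrightarrow>
      ((i, b), (k, c)) \<in> (leN_step K B)\<^sup>*"
proof -
  let ?D = "\<lambda>k. coeff k (diff K (Suc k) (atom K B i b True (Suc k)))"
  let ?le = "\<lambda>k. \<forall>c. (?D k c < 0 \<longrightarrow> ((k, c), (i, b)) \<in> (leN_step K B)\<^sup>*) \<and>
    (0 < ?D k c \<longrightarrow> ((i, b), (k, c)) \<in> (leN_step K B)\<^sup>*)"
  have "?le k"
  proof -
    obtain j where j: "i = Suc j" using k by (cases i) auto
    have "k \<le> j" using k j by simp
    then show ?thesis
    proof (induction k rule: inc_induct)
      case base
      then show ?case using b leN_step_iff[of b j] by (auto simp: j)
    next
      case (step k)
      have k': "Suc k < i" using step(2) j by simp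
      have D_eq: "?D k c = coeff k (diff K (Suc k) (atom K B i b \<epsilon> (Suc k))) c" for \<epsilon> c
        using k' atom_diff[OF b, of k] by simp
      have pos: "atom K B i b \<epsilon> (Suc k) \<in> pos K (Suc k)" for \<epsilon> using atom_pos[OF b] k' by simp
      have basis: "a \<in> B (Suc k)" if "coeff (Suc k) (atom K B i b \<epsilon> (Suc k)) a \<noteq> 0" for a \<epsilon>
        using that by (rule coeff_nonzero_basis[OF pos_closed[OF pos]])
      show ?case
      proof (intro allI conjI impI)
        fix c assume "?D k c < 0"
        then obtain a where a: "coeff (Suc k) (atom K B i b False (Suc k)) a \<noteq> 0"
          "coeff k (diff K (Suc k) a) c < 0"
          using coeff_diff_support[OF pos, of "-1" False c] by (auto simp: D_eq[of _ False])
        then have "?D (Suc k) a < 0"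
          using coeff_atom(2)[OF b k', of a True] by auto
        with step.IH have "((Suc k, a), (i, b)) \<in> (leN_step K B)\<^sup>*" by blast
        moreover have "((k, c), (Suc k, a)) \<in> leN_step K B"
          using a(2) leN_step_iff[OF basis[OF a(1)]] by simp
        ultimately show "((k, c), (i, b)) \<in> (leN_step K B)\<^sup>*"
          by (rule converse_rtrancl_into_rtrancl[rotated])
      next
        fix c assume "0 < ?D k c"
        then obtain a where a: "coeff (Suc k) (atom K B i b True (Suc k)) a \<noteq> 0"
          "0 < coeff k (diff K (Suc k) a) c"
          using coeff_diff_support[OF pos, of 1 True c] by auto
        then have "0 < ?D (Suc k) a"
          using coeff_atom(1)[OF b k', of a True] by auto
        with step.IH have "((i, b), (Suc k, a)) \<in> (leN_step K B)\<^sup>*" by blast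
        moreover have "((Suc k, a), (k, c)) \<in> leN_step K B"
          using a(2) leN_step_iff[OF basis[OF a(1)]] by simp
        ultimately show "((i, b), (k, c)) \<in> (leN_step K B)\<^sup>*"
          by (rule rtrancl_into_rtrancl)
      qed
    qed
  qed
  then show "?D k c < 0 \<Longrightarrow> ((k, c), (i, b)) \<in> (leN_step K B)\<^sup>*"
    "0 < ?D k c \<Longrightarrow> ((i, b), (k, c)) \<in> (leN_step K B)\<^sup>*" by blast+
qed

end

locale steiner_adc = based_adc +
  assumes unital: "unital K B" and loop_free: "strongly_loop_free K B"
begin

lemma atom_nu_cell: "b \<in> B i \<Longrightarrow> to_matrix i (atom K B i b) \<in> nu_cells K i"
  using unital by (intro atom_cell) (auto simp: unital_def)

lemma minimal_block:
  assumes S: "finite S" "S \<noteq> {}" "S \<subseteq> Sigma UNIV B"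
  obtains s where "s \<in> S" "\<And>t. t \<in> S \<Longrightarrow> (t, s) \<in> (leN_step K B)\<^sup>* \<Longrightarrow> t = s"
proof -
  define R where "R t s \<longleftrightarrow> (t, s) \<in> leN K B \<and> t \<noteq> s" for t s
  have po: "antisym (leN K B)" "trans (leN K B)"
    using loop_free by (simp_all add: strongly_loop_free_def partial_order_on_def preorder_on_def)
  have "asymp_on S R"
    using po(1) by (auto simp: asymp_on_def R_def antisym_def)
  moreover have "transp_on S R"
    using po by (auto simp: transp_on_def R_def intro: transD dest: antisymD)
  ultimately obtain s where s: "s \<in> S" "\<forall>t\<in>S. t \<noteq> s \<longrightarrow> \<not> R t s"
    using Finite_Set.bex_min_element[of S R] S by blast
  show thesis
  proof
    show "s \<in> S" by fact
    fix t assume t: "t \<in> S" "(t, s) \<in> (leN_step K B)\<^sup>*"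
    then have "(t, s) \<in> leN K B" using s(1) S(3) by (auto simp: leN_def)
    then show "t = s" using s(2) t(1) by (auto simp: R_def)
  qed
qed

text \<open>Unitality of the elements of degree 0, each of which is its own atom.\<close>

lemma aug_eq_weight:
  assumes "x \<in> pos K 0"
  shows "aug K x = weight 0 x"
  using assms
proof (induction rule: pos_induct)
  case one
  show ?case using hom_one[OF aug_hom] by (simp add: weight_one)
next
  case (mult x b)
  have "aug K b = 1" using unital mult(2) unfolding unital_def by (metis atom_top)
  then show ?case
    using mult hom_mult[OF aug_hom, of x b]
    by (simp add: pos_closed basis_carrier weight_mult weight_basis)
qed

end

section \<open>Functors out of the category of cells of a strong Steiner complex\<close>

text \<open>Such a cell is an identity, and functors preserve identities.\<close>

lemma functor_trivial_top:
  assumes P: "adc P" and L: "adc L" and G: "inf_functor (nu P) (nu L) G"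
    and x: "x \<in> nu_cells P (Suc i)" and top: "entry x True (Suc i) = \<one>\<^bsub>chain P (Suc i)\<^esub>"
  shows "entry (G (Suc i) x) True (Suc i) = \<one>\<^bsub>chain L (Suc i)\<^esub>"
proof -
  interpret P: adc P by (rule P)
  interpret L: adc L by (rule L)
  interpret G: inf_functor "nu P" "nu L" G by (rule G)
  let ?y = "nu_bound True i x"
  note y = P.cell_with_trivial_top[OF x top]
  have "G i ?y \<in> nu_cells L i" using G.map_cells[of i] y(2) by (auto simp: nu_def)
  moreover have "G (Suc i) (nu_ident P i ?y) = nu_ident L i (G i ?y)"
    using G.map_ident[of ?y i] y(2) by (simp add: nu_def)
  ultimately show ?thesis
    unfolding y(1)[symmetric] by (simp add: entry_nu_ident L.nu_cellD(1))
qed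

locale nu_functor = steiner_adc K B + L: adc L + F: inf_functor "nu K" "nu L" F
  for K :: "'a adc_data" and B and L :: "'b adc_data" and F
begin

definition top_entry :: "nat \<Rightarrow> 'a matrix \<Rightarrow> 'b" where
  "top_entry i x = entry (F i x) True i"

abbreviation atom_cell :: "nat \<Rightarrow> 'a \<Rightarrow> 'a matrix" where
  "atom_cell i b \<equiv> to_matrix i (atom K B i b)"

lemma F_cell: "x \<in> nu_cells K i \<Longrightarrow> F i x \<in> nu_cells L i"
  using F.map_cells[of i] by (auto simp: nu_def)

lemma top_entry_closed: "x \<in> nu_cells K i \<Longrightarrow> top_entry i x \<in> carrier (chain L i)"
  using L.nu_cellD(3)[OF F_cell] by (simp add: top_entry_def)

lemma entry_F_top: "x \<in> nu_cells K i \<Longrightarrow> entry (F i x) \<epsilon> i = top_entry i x"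
  unfolding top_entry_def by (rule L.nu_cell_top[OF F_cell])

lemma entry_F_below:
  assumes x: "x \<in> nu_cells K i" and k: "k < i"
  shows "entry (F i x) \<epsilon> k = top_entry k (nu_bound \<epsilon> k x)"
proof -
  have "F k (nu_bound \<epsilon> k x) = nu_bound \<epsilon> k (F i x)"
    using F.map_src[OF k, of x] F.map_tgt[OF k, of x] x by (cases \<epsilon>) (simp_all add: nu_def)
  then show ?thesis
    using k L.nu_cellD(1)[OF F_cell[OF x]] by (simp add: top_entry_def entry_nu_bound)
qed

lemma top_entry_comp:
  assumes "y \<in> nu_cells K i" "z \<in> nu_cells K i" "k < i" "nu_bound False k y = nu_bound True k z"
  shows "top_entry i (nu_comp K i k y z) = top_entry i y \<otimes>\<^bsub>chain L i\<^esub> top_entry i z"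
  using F.map_comp[of k i y z] assms by (simp add: nu_def top_entry_def entry_nu_comp)

lemma top_entry_trivial:
  assumes x: "x \<in> nu_cells K i" and i: "0 < i" and triv: "entry x True i = \<one>\<^bsub>chain K i\<^esub>"
  shows "top_entry i x = \<one>\<^bsub>chain L i\<^esub>"
  using functor_trivial_top[OF adc_axioms L.adc_axioms F.inf_functor_axioms] x i triv
  by (cases i) (simp_all add: top_entry_def)

text \<open>
  The step from \<open>k + 1\<close> to \<open>k\<close> in stripping a cell down to an atom. In degree \<open>k\<close> the cell
  \<open>x\<close> exceeds the atom by \<open>w\<close>, so the blocks are the atom of \<open>b\<close> and the basis elements in \<open>w\<close>. A minimal
  block is split off by a composition in dimension \<open>k - 1\<close>. If it is the atom, the other factor
  is zero in the highest degree and the excess is gone; if it is an element of \<open>w\<close>, that factor is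
  zero in the highest degree and the rest has a smaller excess. In degree 0 the augmentation leaves
  no room for an excess.
\<close>

lemma top_entry_whiskered_atom:
  assumes b: "b \<in> B i" and ki: "k < i"
    and unwhiskered: "\<And>x. x \<in> nu_cells K i \<Longrightarrow>
      (\<And>\<epsilon> l. k \<le> l \<Longrightarrow> l \<le> i \<Longrightarrow> entry x \<epsilon> l = atom K B i b \<epsilon> l) \<Longrightarrow> top_entry i x = t"
    and x: "x \<in> nu_cells K i" and w: "w \<in> pos K k"
    and x_high: "\<And>\<epsilon> l. k < l \<Longrightarrow> l \<le> i \<Longrightarrow> entry x \<epsilon> l = atom K B i b \<epsilon> l"
    and x_k: "\<And>\<epsilon>. entry x \<epsilon> k = atom K B i b \<epsilon> k \<otimes>\<^bsub>chain K k\<^esub> w"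
  shows "top_entry i x = t"
  using x w x_high x_k
proof (induction "nat (weight k w)" arbitrary: x w rule: less_induct)
  case (less w x)
  note x = less.prems(1) and w = less.prems(2) and x_high = less.prems(3) and x_k = less.prems(4)
  let ?a = "atom K B i b"
  interpret k: comm_group "chain K k" by (rule comm_group_chain)
  interpret L: comm_group "chain L i" by (rule L.comm_group_chain)
  have wc: "w \<in> carrier (chain K k)" using w by (rule pos_closed)
  have ac: "?a \<epsilon> l \<in> carrier (chain K l)" if "l \<le> i" for \<epsilon> l
    using atom_pos[OF b that] by (rule pos_closed)
  have ak: "?a \<epsilon> k \<in> carrier (chain K k)" for \<epsilon> using ac[of k] ki by simp
  show ?case
  proof (cases "w = \<one>\<^bsub>chain K k\<^esub>")
    case True
    then have "entry x \<epsilon> k = ?a \<epsilon> k" for \<epsilon> using x_k ak by simp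
    then show ?thesis using x x_high by (intro unwhiskered) (auto simp: le_less)
  next
    case False
    then have weight: "0 < weight k w"
      using weight_zero[OF w] weight_nonneg[OF w] by (auto simp: less_le)
    have "k \<noteq> 0"
    proof
      assume k0: "k = 0"
      have "aug K (?a True 0) = 1" using unital b by (simp add: unital_def)
      moreover have "aug K (entry x True 0) = aug K (?a True 0) + aug K w"
        using x_k[of True] ak wc hom_mult[OF aug_hom] by (simp add: k0)
      ultimately show False
        using nu_cellD(5)[OF x, of True] aug_eq_weight w weight by (simp add: k0)
    qed
    then obtain j where j: "k = Suc j" by (cases k) auto
    have ji: "j < i" using ki j by simp
    (* The blocks; j = k - 1 is the dimension of the composition. *)
    let ?S = "insert (i, b) (Pair k ` {c. coeff k w c \<noteq> 0})"
    have "?S \<subseteq> Sigma UNIV B" using b coeff_nonzero_basis[OF wc] by auto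
    then obtain s where s: "s \<in> ?S"
      and min: "\<And>t. t \<in> ?S \<Longrightarrow> (t, s) \<in> (leN_step K B)\<^sup>* \<Longrightarrow> t = s"
      using minimal_block[of ?S] by auto
    (* A block producing an element that is below s lies below s itself. *)
    have le_s: "(i, b) = s" if "0 < coeff j (diff K k (?a True k)) c" "((j, c), s) \<in> (leN_step K B)\<^sup>*" for c
      using min[of "(i, b)"] rtrancl_trans[OF atom_boundary_le(2)[OF b ji, of c], of s] that by (simp add: j)
    have le_s': "(k, a) = s"
      if "coeff k w a \<noteq> 0" "0 < coeff j (diff K k a) c" "((j, c), s) \<in> (leN_step K B)\<^sup>*" for a c
    proof (rule min)
      have "a \<in> B (Suc j)" using that(1) coeff_nonzero_basis[OF wc] j by simp
      then have "((k, a), (j, c)) \<in> leN_step K B" using leN_step_iff(2) that(2) by (simp add: j)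
      then show "((k, a), s) \<in> (leN_step K B)\<^sup>*" using that(3) by (rule converse_rtrancl_into_rtrancl)
    qed (use that(1) in auto)
    show ?thesis
    proof (cases "s = (i, b)")
      case True
      obtain y z where yz: "y \<in> nu_cells K i" "z \<in> nu_cells K i"
        "nu_bound False j y = nu_bound True j z" "x = nu_comp K i j y z"
        "\<And>\<epsilon> l. j < l \<Longrightarrow> l \<le> i \<Longrightarrow> entry y \<epsilon> l = (if l = k then w else \<one>\<^bsub>chain K l\<^esub>)"
        "\<And>\<epsilon> l. j < l \<Longrightarrow> l \<le> i \<Longrightarrow> entry z \<epsilon> l = ?a \<epsilon> l"
      proof (rule cell_split[OF x ji, where p = ?a and q = "\<lambda>\<epsilon> l. if l = k then w else \<one>\<^bsub>chain K l\<^esub>"])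
        show "entry x \<epsilon> l = (if l = k then w else \<one>\<^bsub>chain K l\<^esub>) \<otimes>\<^bsub>chain K l\<^esub> ?a \<epsilon> l"
          if "j < l" "l \<le> i" for \<epsilon> l
        proof -
          interpret l: comm_group "chain K l" by (rule comm_group_chain)
          show ?thesis
          proof (cases "l = k")
            case True
            then show ?thesis using ak wc x_k by (simp add: k.m_comm)
          next
            case False
            then show ?thesis using that ac[of l] x_high[of l] j by simp
          qed
        qed
        fix c assume neg: "coeff j (diff K (Suc j) (?a True (Suc j))) c < 0"
        then have le: "((j, c), s) \<in> (leN_step K B)\<^sup>*"
          unfolding True by (rule atom_boundary_le(1)[OF b ji])
        have "\<not> 0 < coeff j (diff K k w) c"
        proof
          assume "0 < coeff j (diff K k w) c"
          then obtain a where "coeff k w a \<noteq> 0" "0 < coeff j (diff K k a) c"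
            using coeff_diff_support[of w j 1 c] w by (auto simp: j)
          from le_s'[OF this le] show False using True ki by simp
        qed
        then show "coeff j (diff K (Suc j) (if Suc j = k then w else \<one>\<^bsub>chain K (Suc j)\<^esub>)) c \<le> 0"
          by (simp add: j)
      qed (use atom_pos[OF b] atom_diff[OF b] w ji in auto)
      have "top_entry i y = \<one>\<^bsub>chain L i\<^esub>"
        using yz(5)[of i] ki ji yz(1) by (intro top_entry_trivial) auto
      moreover have "top_entry i z = t"
        using yz(2,6) j by (intro unwhiskered) auto
      ultimately show ?thesis
        using top_entry_comp[OF yz(1,2) ji yz(3)] top_entry_closed[OF yz(2)] yz(4) by simp
    next
      case s_ne: False
      then obtain c\<^sub>0 where c0: "s = (k, c\<^sub>0)" "coeff k w c\<^sub>0 \<noteq> 0" using s by auto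
      have c0B: "c\<^sub>0 \<in> B k" using c0(2) coeff_nonzero_basis[OF wc] by blast
      have c0c: "c\<^sub>0 \<in> carrier (chain K k)" using c0B by (rule basis_carrier)
      define w' where "w' = w \<otimes>\<^bsub>chain K k\<^esub> inv\<^bsub>chain K k\<^esub> c\<^sub>0"
      have w': "w' \<in> pos K k" unfolding w'_def using w c0(2) by (rule pos_remove)
      have w'c: "w' \<in> carrier (chain K k)" using w' by (rule pos_closed)
      have w_eq: "w = w' \<otimes>\<^bsub>chain K k\<^esub> c\<^sub>0"
        using wc c0c by (simp add: w'_def k.m_assoc)
      let ?p = "\<lambda>(\<epsilon>::bool) l. if l = k then c\<^sub>0 else \<one>\<^bsub>chain K l\<^esub>"
      let ?q = "\<lambda>\<epsilon> l. if l = k then ?a \<epsilon> k \<otimes>\<^bsub>chain K k\<^esub> w' else ?a \<epsilon> l"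
      obtain y z where yz: "y \<in> nu_cells K i" "z \<in> nu_cells K i"
        "nu_bound False j y = nu_bound True j z" "x = nu_comp K i j y z"
        "\<And>\<epsilon> l. j < l \<Longrightarrow> l \<le> i \<Longrightarrow> entry y \<epsilon> l = ?q \<epsilon> l"
        "\<And>\<epsilon> l. j < l \<Longrightarrow> l \<le> i \<Longrightarrow> entry z \<epsilon> l = ?p \<epsilon> l"
      proof (rule cell_split[OF x ji, where p = ?p and q = ?q])
        show "entry x \<epsilon> l = ?q \<epsilon> l \<otimes>\<^bsub>chain K l\<^esub> ?p \<epsilon> l" if "j < l" "l \<le> i" for \<epsilon> l
        proof -
          interpret l: comm_group "chain K l" by (rule comm_group_chain)
          show ?thesis
          proof (cases "l = k")
            case True
            then show ?thesis using ak w'c c0c x_k by (simp add: w_eq k.m_assoc)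
          next
            case False
            then show ?thesis using that ac[of l] x_high[of l] j by simp
          qed
        qed
        show "diff K (Suc l) (?p \<epsilon> (Suc l)) = ?p True l \<otimes>\<^bsub>chain K l\<^esub> inv\<^bsub>chain K l\<^esub> ?p False l"
          if "j < l" for \<epsilon> l
        proof -
          interpret l: comm_group "chain K l" by (rule comm_group_chain)
          show ?thesis using that c0c by (simp add: j diff_one)
        qed
        fix c assume neg: "coeff j (diff K (Suc j) (?p True (Suc j))) c < 0"
        then have "((j, c), s) \<in> leN_step K B"
          using leN_step_iff(1)[of "c\<^sub>0" j c] c0B by (simp add: j c0)
        then have le: "((j, c), s) \<in> (leN_step K B)\<^sup>*" by blast
        have "\<not> 0 < coeff j (diff K k (?a True k)) c"
          using le_s[OF _ le] s_ne by blast
        moreover have "\<not> 0 < coeff j (diff K k w') c"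
        proof
          assume "0 < coeff j (diff K k w') c"
          then obtain a where a: "coeff k w' a \<noteq> 0" "0 < coeff j (diff K k a) c"
            using coeff_diff_support[of w' j 1 c] w' by (auto simp: j)
          have "coeff k w a \<noteq> 0"
            using a(1) w' c0B w'c c0c unfolding w_eq pos_eq
            by (auto simp: add_nonneg_eq_0_iff)
          from le_s'[OF this a(2) le] have "a = c\<^sub>0" by (simp add: c0)
          then show False using neg a(2) by (simp add: j)
        qed
        ultimately show "coeff j (diff K (Suc j) (?q True (Suc j))) c \<le> 0"
          using ak w'c by (simp add: j diff_mult diff_closed)
      qed (use atom_pos[OF b] w' basis_pos[OF c0B] ji ki in auto)
      have "top_entry i z = \<one>\<^bsub>chain L i\<^esub>"
        using yz(6)[of i] ki ji yz(2) by (intro top_entry_trivial) auto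
      moreover have "top_entry i y = t"
      proof (rule less.hyps)
        show "nat (weight k w') < nat (weight k w)"
          using weight weight_remove[OF w c0(2)] by (simp add: w'_def)
        show "entry y \<epsilon> l = ?a \<epsilon> l" if "k < l" "l \<le> i" for \<epsilon> l using yz(5)[of l] that j by simp
        show "entry y \<epsilon> k = ?a \<epsilon> k \<otimes>\<^bsub>chain K k\<^esub> w'" for \<epsilon> using yz(5)[of k] ki j by simp
      qed (fact yz(1) w')+
      ultimately show ?thesis
        using top_entry_comp[OF yz(1,2) ji yz(3)] top_entry_closed[OF yz(1)] yz(4) by simp
    qed
  qed
qed

text \<open>
  By induction on \<open>k\<close>; for \<open>k = 0\<close> the cell is the atom. The excess \<open>w\<close> over the atom in degree \<open>k\<close>
  is the same for source and target, since both differences are \<open>d x\<^sub>k\<^sub>+\<^sub>1\<close>, and it is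
  positive because an atom consists of the two parts of this chain, with disjoint supports, and
  is therefore the least solution.
\<close>

lemma top_entry_of_single_basis_element:
  assumes b: "b \<in> B i" and "k \<le> i" and x: "x \<in> nu_cells K i"
    and high: "\<And>\<epsilon> l. k \<le> l \<Longrightarrow> l \<le> i \<Longrightarrow> entry x \<epsilon> l = atom K B i b \<epsilon> l"
  shows "top_entry i x = top_entry i (atom_cell i b)"
  using assms(2-)
proof (induction k arbitrary: x)
  case 0
  then have "x = atom_cell i b"
    by (intro matrix_eqI) (auto simp: nu_cellD(1)[OF 0(2)])
  then show ?case by simp
next
  case (Suc k x)
  let ?a = "atom K B i b"
  have k: "k < i" using Suc.prems(1) by simp
  define w where "w = entry x False k \<otimes>\<^bsub>chain K k\<^esub> inv\<^bsub>chain K k\<^esub> ?a False k"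
  have xc: "entry x \<epsilon> k \<in> carrier (chain K k)" for \<epsilon> using nu_cellD(3)[OF Suc.prems(2)] k by simp
  have ac: "?a \<epsilon> k \<in> carrier (chain K k)" for \<epsilon> using atom_pos[OF b] k by (simp add: pos_closed)
  have wc: "w \<in> carrier (chain K k)" using xc ac by (simp add: w_def)
  let ?d = "\<lambda>c. coeff k (diff K (Suc k) (?a True (Suc k))) c"
  have d: "?d c = coeff k (entry x True k) c - coeff k (entry x False k) c" for c
    using coeff_cell_diff[OF Suc.prems(2) k, of True c] Suc.prems(3)[of "Suc k" True] k by simp
  note a = coeff_atom[OF b k, where \<epsilon> = True]
  have nonneg: "0 \<le> coeff k (entry x \<epsilon> k) c" for \<epsilon> c
    using nu_cellD(2)[OF Suc.prems(2), of k \<epsilon>] k by (simp add: pos_eq)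
  have "0 \<le> coeff k w c" for c
    using nonneg[of True c] nonneg[of False c] d[of c] a(2)[of c] xc ac by (simp add: w_def)
  then have w: "w \<in> pos K k" using wc by (simp add: pos_eq)
  have x_k: "entry x \<epsilon> k = ?a \<epsilon> k \<otimes>\<^bsub>chain K k\<^esub> w" for \<epsilon>
  proof (rule coeff_eqI[where i = k])
    show "coeff k (entry x \<epsilon> k) c = coeff k (?a \<epsilon> k \<otimes>\<^bsub>chain K k\<^esub> w) c" for c
      using d[of c] a[of c] xc ac wc by (cases \<epsilon>) (simp_all add: w_def)
  qed (use xc ac wc in simp_all)
  show ?case
    using Suc.IH k by (intro top_entry_whiskered_atom[OF b k _ Suc.prems(2) w Suc.prems(3) x_k]) auto
qed

text \<open>
  By induction on the number of basis elements in the highest entry. The blocks are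
  these elements, and a minimal one is split off by a composition of codimension one.
\<close>

lemma top_entry_linear:
  assumes f: "f \<in> hom (chain K i) (chain L i)"
    and f_atom: "\<And>b. b \<in> B i \<Longrightarrow> f b = top_entry i (atom_cell i b)"
    and x: "x \<in> nu_cells K i"
  shows "top_entry i x = f (entry x True i)"
  using x
proof (induction "nat (weight i (entry x True i))" arbitrary: x rule: less_induct)
  case (less x)
  note x = less.prems
  let ?u = "entry x True i"
  interpret G: comm_group "chain K i" by (rule comm_group_chain)
  interpret f: group_hom "chain K i" "chain L i" f
    using L.comm_group_chain f
    by (simp add: group_hom_def group_hom_axioms_def comm_group_def)
  have u: "?u \<in> pos K i" using nu_cellD(2)[OF x] by simp
  have uc: "?u \<in> carrier (chain K i)" using u by (rule pos_closed)
  show ?case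
  proof (cases "?u = \<one>\<^bsub>chain K i\<^esub>")
    case True
    have "i \<noteq> 0"
    proof
      assume "i = 0"
      then have "aug K ?u = 0" using True aug_eq_weight[OF one_pos] by (simp add: weight_one)
      then show False using nu_cellD(5)[OF x, of True] \<open>i = 0\<close> by simp
    qed
    then show ?thesis using top_entry_trivial[OF x] True by simp
  next
    case False
    let ?S = "Pair i ` {c. coeff i ?u c \<noteq> 0}"
    have "?S \<noteq> {}" using False coeff_eqI[OF uc one_closed] by fastforce
    moreover have "?S \<subseteq> Sigma UNIV B"
    proof
      fix t assume "t \<in> ?S"
      then obtain c where "t = (i, c)" "coeff i ?u c \<noteq> 0" by blast
      then show "t \<in> Sigma UNIV B" using coeff_nonzero_basis[OF uc, of c] by simp
    qed
    ultimately obtain s where s: "s \<in> ?S"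
      and min_s: "\<And>t. t \<in> ?S \<Longrightarrow> (t, s) \<in> (leN_step K B)\<^sup>* \<Longrightarrow> t = s"
      using minimal_block[OF finite_imageI[OF finite_coeff]] by metis
    obtain a where s_eq: "s = (i, a)" and a: "coeff i ?u a \<noteq> 0" using s by blast
    have min: "a' = a" if "coeff i ?u a' \<noteq> 0" "((i, a'), (i, a)) \<in> (leN_step K B)\<^sup>*" for a'
      using min_s[of "(i, a')"] that unfolding s_eq by blast
    have aB: "a \<in> B i" using a coeff_nonzero_basis[OF uc] by blast
    have ac: "a \<in> carrier (chain K i)" using aB by (rule basis_carrier)
    define r where "r = ?u \<otimes>\<^bsub>chain K i\<^esub> inv\<^bsub>chain K i\<^esub> a"
    have r: "r \<in> pos K i" unfolding r_def using u a by (rule pos_remove)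
    have rc: "r \<in> carrier (chain K i)" using r by (rule pos_closed)
    have u_eq: "?u = r \<otimes>\<^bsub>chain K i\<^esub> a" using uc ac by (simp add: r_def G.m_assoc)
    have wr: "weight i r = weight i ?u - 1" unfolding r_def using u a by (rule weight_remove)
    have single: "top_entry i z = f a" if z: "z \<in> nu_cells K i" "entry z True i = a" for z
    proof -
      have "entry z \<epsilon> l = atom K B i a \<epsilon> l" if "i \<le> l" "l \<le> i" for \<epsilon> l
        using that z(2) nu_cell_top[OF z(1), of \<epsilon>] by (simp add: le_antisym)
      then have "top_entry i z = top_entry i (atom_cell i a)" by (intro top_entry_of_single_basis_element[OF aB order_refl z(1)])
      then show ?thesis using f_atom[OF aB] by simp
    qed
    show ?thesis
    proof (cases i)
      case 0
      then have "weight i ?u = 1" using nu_cellD(5)[OF x, of True] aug_eq_weight u by simp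
      then have "r = \<one>\<^bsub>chain K i\<^esub>" using wr weight_zero[OF r] by simp
      then show ?thesis using single[OF x] u_eq ac by simp
    next
      case (Suc k)
      have k: "k < i" using Suc by simp
      have only_i: "l = i" if "k < l" "l \<le> i" for l using that Suc by simp
      obtain y z where yz: "y \<in> nu_cells K i" "z \<in> nu_cells K i"
        "nu_bound False k y = nu_bound True k z" "x = nu_comp K i k y z"
        "\<And>\<epsilon> l. k < l \<Longrightarrow> l \<le> i \<Longrightarrow> entry y \<epsilon> l = r"
        "\<And>\<epsilon> l. k < l \<Longrightarrow> l \<le> i \<Longrightarrow> entry z \<epsilon> l = a"
      proof (rule cell_split[OF x k, where p = "\<lambda>_ _. a" and q = "\<lambda>_ _. r"])
        show "entry x \<epsilon> l = r \<otimes>\<^bsub>chain K l\<^esub> a" if "k < l" "l \<le> i" for \<epsilon> l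
          using only_i[OF that] nu_cell_top[OF x, of \<epsilon>] u_eq by simp
        show "a \<in> pos K l" if "k < l" "l \<le> i" for l
          using only_i[OF that] basis_pos[OF aB] by simp
        show "r \<in> pos K l" if "k < l" "l \<le> i" for l
          using only_i[OF that] r by simp
        fix c assume neg: "coeff k (diff K (Suc k) a) c < 0"
        show "coeff k (diff K (Suc k) r) c \<le> 0"
        proof (rule ccontr)
          assume "\<not> ?thesis"
          then obtain a' where a': "coeff i r a' \<noteq> 0" "0 < coeff k (diff K (Suc k) a') c"
            using coeff_diff_support[of r k 1 c] r Suc by auto
          have u': "coeff i ?u a' \<noteq> 0"
            using a'(1) r rc ac aB unfolding u_eq pos_eq by (auto simp: add_nonneg_eq_0_iff)
          then have "a' \<in> B i" using coeff_nonzero_basis[OF uc] by blast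
          then have "((i, a'), (k, c)) \<in> leN_step K B" "((k, c), (i, a)) \<in> leN_step K B"
            using leN_step_iff[of _ k c] a'(2) neg aB Suc by auto
          then have "a' = a"
            by (intro min[OF u']) (meson converse_rtrancl_into_rtrancl r_into_rtrancl)
          then show False using a'(2) neg by simp
        qed
      qed (use Suc in auto)
      have "top_entry i y = f (entry y True i)"
        using yz(1,5) wr k weight_nonneg[OF r] by (intro less.hyps) simp_all
      then have "top_entry i y = f r" using yz(5) k by simp
      moreover have "top_entry i z = f a" using yz(2,6) k by (intro single) simp_all
      moreover have "f ?u = f r \<otimes>\<^bsub>chain L i\<^esub> f a" unfolding u_eq using rc ac by simp
      ultimately show ?thesis
        using top_entry_comp[OF yz(1,2) k yz(3)] yz(4) by simp
    qed
  qed
qed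

text \<open>
  The map \<open>f\<close> is the linear extension \<open>h\<close> of the highest entries of the images of the atoms,
  restricted to the carriers to make it extensional. Its compatibility with \<open>d\<close>, positivity and
  the augmentation are read off from the image of each atom being a cell of \<open>nu L\<close>.
\<close>

lemma functor_eq_nu_map: "\<exists>f. adc_morphism K L f \<and> nu_map K f = F"
proof -
  have "\<exists>h. h \<in> hom (chain K i) (chain L i) \<and> (\<forall>b\<in>B i. h b = top_entry i (atom_cell i b))" for i
  proof -
    interpret comm_group "chain K i" by (rule comm_group_chain)
    show ?thesis
      using top_entry_closed[OF atom_nu_cell]
      by (rule_tac hom_from_int_basis[OF int_basis L.comm_group_chain, of "\<lambda>b. top_entry i (atom_cell i b)"]) auto
  qed
  then obtain h where h: "\<And>i. h i \<in> hom (chain K i) (chain L i)"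
    and h_atom: "\<And>i b. b \<in> B i \<Longrightarrow> h i b = top_entry i (atom_cell i b)" by metis
  have top_h: "top_entry i x = h i (entry x True i)" if "x \<in> nu_cells K i" for i x
    using top_entry_linear[OF h h_atom that] .
  have entry_F: "entry (F i x) \<epsilon> k = h k (entry x \<epsilon> k)" if x: "x \<in> nu_cells K i" "k \<le> i" for i x \<epsilon> k
  proof (cases "k = i")
    case True
    then show ?thesis using entry_F_top[OF x(1)] top_h[OF x(1)] nu_cell_top[OF x(1), of \<epsilon>] by simp
  next
    case False
    then have k: "k < i" using x(2) by simp
    then show ?thesis
      using entry_F_below[OF x(1) k] top_h[OF nu_bound_cell[OF x(1) k]] nu_cellD(1)[OF x(1)]
      by (simp add: entry_nu_bound)
  qed
  have closed: "h i x \<in> carrier (chain L i)" if "x \<in> carrier (chain K i)" for i x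
    using hom_in_carrier[OF h that] .
  have diff: "h i (diff K (Suc i) x) = diff L (Suc i) (h (Suc i) x)"
    if x: "x \<in> carrier (chain K (Suc i))" for i x
  proof -
    interpret G: group_hom "chain K i" "chain L i" "h i"
      using L.comm_group_chain h by (simp add: group_hom_def group_hom_axioms_def comm_group_def)
    have "(h i \<circ> diff K (Suc i)) x = (diff L (Suc i) \<circ> h (Suc i)) x"
    proof (rule hom_eqI[OF G.H.is_group _ _ _ x])
      show "h i \<circ> diff K (Suc i) \<in> hom (chain K (Suc i)) (chain L i)"
        by (rule hom_compose[OF diff_hom h])
      show "diff L (Suc i) \<circ> h (Suc i) \<in> hom (chain K (Suc i)) (chain L i)"
        by (rule hom_compose[OF h L.diff_hom])
      fix b assume b: "b \<in> B (Suc i)"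
      let ?A = "atom K B (Suc i) b"
      have ac: "?A \<epsilon> i \<in> carrier (chain K i)" for \<epsilon> using atom_pos[OF b, of i] by (simp add: pos_closed)
      have "diff K (Suc i) b = ?A True i \<otimes>\<^bsub>chain K i\<^esub> inv\<^bsub>chain K i\<^esub> ?A False i"
        using atom_diff[OF b, of i True] by simp
      then show "(h i \<circ> diff K (Suc i)) b = (diff L (Suc i) \<circ> h (Suc i)) b"
        using L.nu_cellD(4)[OF F_cell[OF atom_nu_cell[OF b]], of i True] ac
        by (simp add: entry_F atom_nu_cell[OF b])
    qed
    then show ?thesis by simp
  qed
  have pos: "h i x \<in> pos L i" if "x \<in> pos K i" for i x
    using that
  proof (induction rule: pos_induct)
    case one
    have "h i \<one>\<^bsub>chain K i\<^esub> = \<one>\<^bsub>chain L i\<^esub>"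
      using hom_one[OF h] L.comm_group_chain by (simp add: comm_group_def)
    then show ?case using submonoid.one_closed[OF L.submonoid_pos] by simp
  next
    case (mult x b)
    have "h i b \<in> pos L i"
      using h_atom[OF mult(2)] L.nu_cellD(2)[OF F_cell[OF atom_nu_cell[OF mult(2)]], of i True]
      by (simp add: top_entry_def)
    then show ?case
      using mult hom_mult[OF h] submonoid.m_closed[OF L.submonoid_pos]
      by (simp add: pos_closed basis_carrier)
  qed
  have aug: "aug L (h 0 x) = aug K x" if x: "x \<in> carrier (chain K 0)" for x
  proof -
    have "(aug L \<circ> h 0) x = aug K x"
    proof (rule hom_eqI[OF _ _ aug_hom _ x])
      show "aug L \<circ> h 0 \<in> hom (chain K 0) integer_group" by (rule hom_compose[OF h L.aug_hom])
      show "(aug L \<circ> h 0) b = aug K b" if b: "b \<in> B 0" for b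
        using L.nu_cellD(5)[OF F_cell[OF atom_nu_cell[OF b]], of True] nu_cellD(5)[OF atom_nu_cell[OF b], of True]
        by (simp add: entry_F atom_nu_cell[OF b])
    qed simp
    then show ?thesis by simp
  qed
  define f where "f i = restrict (h i) (carrier (chain K i))" for i
  have f: "f i x = h i x" if "x \<in> carrier (chain K i)" for i x using that by (simp add: f_def)
  have mor: "adc_morphism K L f"
  proof unfold_locales
    show "f i \<in> extensional (carrier (chain K i))" for i by (simp add: f_def)
    show "f i \<in> hom (chain K i) (chain L i)" for i
      using h[of i] by (auto simp: hom_def f_def)
    show "f i ` pos K i \<subseteq> pos L i" for i using pos by (auto simp: f pos_closed)
  qed (simp_all add: f diff_closed diff aug)
  interpret f: adc_morphism K L f by (rule mor)
  have "nu_map K f i x = F i x" for i x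
  proof (cases "x \<in> nu_cells K i")
    case True
    show ?thesis
    proof (rule matrix_eqI)
      show "entry (nu_map K f i x) \<epsilon> k = entry (F i x) \<epsilon> k" if "k < length (nu_map K f i x)" for \<epsilon> k
        using that True nu_cellD(3)[OF True] by (simp add: f.nu_map_eq entry_F f)
    qed (simp add: f.nu_map_eq True L.nu_cellD(1)[OF F_cell[OF True]])
  next
    case False
    then have "F i x = undefined"
      by (intro PiE_arb[OF F.map_cells]) (simp add: nu_def)
    then show ?thesis using False by (simp add: nu_map_def)
  qed
  then show ?thesis using mor by blast
qed

end

text \<open>Evaluating at the atom of \<open>b\<close> recovers \<open>f b\<close> as its highest entry.\<close>

lemma (in steiner_adc) nu_map_faithful:
  assumes f: "adc_morphism K L f" and g: "adc_morphism K L g" and eq: "nu_map K f = nu_map K g"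
  shows "f = g"
proof (intro ext)
  fix i x
  interpret f: adc_morphism K L f by (rule f)
  interpret g: adc_morphism K L g by (rule g)
  show "f i x = g i x"
  proof (cases "x \<in> carrier (chain K i)")
    case True
    have "group (chain L i)" using f.target.comm_group_chain by (simp add: comm_group_def)
    then show ?thesis
    proof (rule hom_eqI[OF _ f.map_hom g.map_hom _ True])
      fix b assume b: "b \<in> B i"
      show "f i b = g i b"
        using f.nu_map_eq(2)[OF atom_nu_cell[OF b] order_refl, of True]
          g.nu_map_eq(2)[OF atom_nu_cell[OF b] order_refl, of True] eq by simp
    qed
  next
    case False
    show ?thesis
      using extensional_arb[OF f.map_extensional False] extensional_arb[OF g.map_extensional False]
      by simp
  qed
qed

theorem nu_fully_faithful_strong_steiner:
  assumes K: "strong_steiner K" and L: "adc L"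
  shows "nu_fully_faithful K L"
proof -
  obtain B where B: "adc K" "adc_basis K B" "unital K B" "strongly_loop_free K B"
    using K by (auto simp: strong_steiner_def)
  interpret steiner_adc K B
    by (intro steiner_adc.intro based_adc.intro steiner_adc_axioms.intro based_adc_axioms.intro B)
  show ?thesis
    unfolding nu_fully_faithful_def bij_betw_def
  proof
    show "inj_on (nu_map K) (adc_hom K L)"
      using nu_map_faithful by (auto simp: inj_on_def adc_hom_def)
    show "nu_map K ` adc_hom K L = inf_cat_hom (nu K) (nu L)"
    proof (intro equalityI subsetI)
      fix F assume "F \<in> nu_map K ` adc_hom K L"
      then show "F \<in> inf_cat_hom (nu K) (nu L)"
        using adc_morphism.inf_functor_nu_map by (auto simp: adc_hom_def inf_cat_hom_def)
    next
      fix F assume "F \<in> inf_cat_hom (nu K) (nu L)"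
      then have "inf_functor (nu K) (nu L) F" by (simp add: inf_cat_hom_def)
      then interpret nu_functor K B L F
        by (intro nu_functor.intro steiner_adc_axioms L steiner_adc.intro based_adc_axioms)
      show "F \<in> nu_map K ` adc_hom K L"
        using functor_eq_nu_map by (auto simp: adc_hom_def)
    qed
  qed
qed

section \<open>Passing to quotients of the source\<close>

lemma inf_functor_compose:
  assumes F: "inf_functor C D F" and G: "inf_functor D E G"
  shows "inf_functor C E (\<lambda>i. compose (cells C i) (G i) (F i))"
proof -
  interpret F: inf_functor C D F by (rule F)
  interpret G: inf_functor D E G by (rule G)
  have cell: "F i x \<in> cells D i" if "x \<in> cells C i" for i x using F.map_cells that by blast
  have cell': "G i x \<in> cells E i" if "x \<in> cells D i" for i x using G.map_cells that by blast
  have comparable: "src D i j (F i x) = tgt D i j (F i y)"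
    if "j < i" "x \<in> cells C i" "y \<in> cells C i" "src C i j x = tgt C i j y" for i j x y
    using F.map_src[OF that(1,2)] F.map_tgt[OF that(1,3)] that(4) by simp
  show ?thesis
    by unfold_locales
      (auto simp: compose_def F.source.src_cell F.source.tgt_cell F.source.ident_cell
        F.source.comp_cell F.map_src F.map_tgt F.map_ident F.map_comp G.map_src G.map_tgt
        G.map_ident G.map_comp cell cell' comparable)
qed

lemma adc_morphism_descend:
  assumes p: "adc_morphism K P p" and g: "adc_morphism K L g"
    and surj: "\<And>i. carrier (chain P i) = p i ` carrier (chain K i)"
    and surj_pos: "\<And>i. pos P i \<subseteq> p i ` pos K i"
    and fibres: "\<And>i x y. x \<in> carrier (chain K i) \<Longrightarrow> y \<in> carrier (chain K i) \<Longrightarrow>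
      p i x = p i y \<Longrightarrow> g i x = g i y"
  obtains f where "adc_morphism P L f" "adc_compose K f p = g"
proof -
  interpret p: adc_morphism K P p by (rule p)
  interpret g: adc_morphism K L g by (rule g)
  define f where "f i = (\<lambda>X\<in>carrier (chain P i). g i (SOME x. x \<in> carrier (chain K i) \<and> p i x = X))" for i
  have f: "f i (p i x) = g i x" if x: "x \<in> carrier (chain K i)" for i x
  proof -
    let ?y = "SOME y. y \<in> carrier (chain K i) \<and> p i y = p i x"
    have "?y \<in> carrier (chain K i) \<and> p i ?y = p i x"
      by (rule someI[of _ x]) (simp add: x)
    then show ?thesis using fibres[of ?y i x] x p.map_carrier[OF x] by (simp add: f_def)
  qed
  have f_hom: "f i \<in> hom (chain P i) (chain L i)" for i
  proof -
    interpret comm_group "chain K i" by (rule p.source.comm_group_chain)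
    show ?thesis
      unfolding hom_def surj
      using f p.map_mult g.map_mult g.map_carrier by (auto simp flip: p.map_mult)
  qed
  have "adc_morphism P L f"
  proof unfold_locales
    show "f i \<in> extensional (carrier (chain P i))" for i by (simp add: f_def)
    show "f i (diff P (Suc i) x) = diff L (Suc i) (f (Suc i) x)" if "x \<in> carrier (chain P (Suc i))" for i x
      using that by (auto simp: surj f g.map_diff p.source.diff_closed simp flip: p.map_diff)
    show "f i ` pos P i \<subseteq> pos L i" for i
    proof
      fix Y assume "Y \<in> f i ` pos P i"
      then obtain x where "x \<in> pos K i" "Y = f i (p i x)" using surj_pos[of i] by auto
      then show "Y \<in> pos L i" using g.map_pos[of i] by (auto simp: f p.source.pos_closed)
    qed
    show "aug L (f 0 x) = aug P x" if "x \<in> carrier (chain P 0)" for x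
      using that by (auto simp: surj f g.map_aug p.map_aug)
  qed (rule f_hom)
  moreover have "adc_compose K f p = g"
  proof (intro ext)
    show "adc_compose K f p i x = g i x" for i x
    proof (cases "x \<in> carrier (chain K i)")
      case True
      then show ?thesis by (simp add: adc_compose_def compose_eq f)
    next
      case False
      then show ?thesis
        using extensional_arb[OF g.map_extensional False] by (simp add: adc_compose_def compose_def)
    qed
  qed
  ultimately show thesis by (rule that)
qed

text \<open>
  Full faithfulness passes from \<open>K\<close> to a quotient \<open>P\<close> all of whose cells lift. A functor \<open>G\<close> on
  \<open>nu P\<close> pulls back to a functor on \<open>nu K\<close>, which comes from a morphism \<open>g\<close>; the assumption
  \<open>fibres\<close> is that the morphisms \<open>g\<close> that arise in this way are constant on the fibres of \<open>p\<close>.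
  Surjectivity of \<open>p\<close> on chains gives uniqueness, on cells it gives that the induced
  morphism realises \<open>G\<close>.
\<close>

lemma nu_fully_faithful_quotient:
  assumes p: "adc_morphism K P p" and L: "adc L" and ff: "nu_fully_faithful K L"
    and surj: "\<And>i. carrier (chain P i) = p i ` carrier (chain K i)"
    and surj_pos: "\<And>i. pos P i \<subseteq> p i ` pos K i"
    and surj_cells: "\<And>i. nu_cells P i \<subseteq> nu_map K p i ` nu_cells K i"
    and fibres: "\<And>G g i x y. inf_functor (nu P) (nu L) G \<Longrightarrow> adc_morphism K L g \<Longrightarrow>
      (\<And>i x. x \<in> nu_cells K i \<Longrightarrow> nu_map K g i x = G i (nu_map K p i x)) \<Longrightarrow>
      x \<in> carrier (chain K i) \<Longrightarrow> y \<in> carrier (chain K i) \<Longrightarrow> p i x = p i y \<Longrightarrow> g i x = g i y"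
  shows "nu_fully_faithful P L"
proof -
  interpret p: adc_morphism K P p by (rule p)
  have bij: "inj_on (nu_map K) (adc_hom K L)" "nu_map K ` adc_hom K L = inf_cat_hom (nu K) (nu L)"
    using ff by (simp_all add: nu_fully_faithful_def bij_betw_def)
  have inj: "f = f'" if "adc_morphism K L f" "adc_morphism K L f'" "nu_map K f = nu_map K f'" for f f'
    by (rule inj_onD[OF bij(1)]) (simp_all add: adc_hom_def that)
  have full: "\<exists>f. adc_morphism K L f \<and> nu_map K f = F" if "inf_functor (nu K) (nu L) F" for F
  proof -
    have "F \<in> nu_map K ` adc_hom K L" using that by (simp add: bij(2) inf_cat_hom_def)
    then show ?thesis by (auto simp: adc_hom_def)
  qed
  have compose: "nu_map K (adc_compose K f p) i = compose (nu_cells K i) (nu_map P f i) (nu_map K p i)"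
    if "adc_morphism P L f" for f i
    using p that by (rule nu_map_compose)
  have "inj_on (nu_map P) (adc_hom P L)"
  proof (rule inj_onI)
    fix f f' assume "f \<in> adc_hom P L" "f' \<in> adc_hom P L" and eq: "nu_map P f = nu_map P f'"
    then have f: "adc_morphism P L f" and f': "adc_morphism P L f'" by (simp_all add: adc_hom_def)
    interpret f: adc_morphism P L f by (rule f)
    interpret f': adc_morphism P L f' by (rule f')
    have "nu_map K (adc_compose K f p) = nu_map K (adc_compose K f' p)"
      using eq by (intro ext) (simp add: compose f f')
    then have c: "adc_compose K f p = adc_compose K f' p"
      by (intro inj p.adc_morphism_compose f f')
    have "f i (p i x) = f' i (p i x)" if "x \<in> carrier (chain K i)" for i x
      using fun_cong[OF fun_cong[OF c], of i x] that by (simp add: adc_compose_def compose_eq)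
    then have "f i X = f' i X" if "X \<in> carrier (chain P i)" for i X
      using that by (auto simp: surj)
    then show "f = f'"
      by (intro ext extensionalityI[OF f.map_extensional f'.map_extensional])
  qed
  moreover have "nu_map P ` adc_hom P L = inf_cat_hom (nu P) (nu L)"
  proof (intro equalityI subsetI)
    show "G \<in> inf_cat_hom (nu P) (nu L)" if "G \<in> nu_map P ` adc_hom P L" for G
      using that adc_morphism.inf_functor_nu_map by (auto simp: adc_hom_def inf_cat_hom_def)
  next
    fix G assume "G \<in> inf_cat_hom (nu P) (nu L)"
    then have G: "inf_functor (nu P) (nu L) G" by (simp add: inf_cat_hom_def)
    interpret G: inf_functor "nu P" "nu L" G by (rule G)
    obtain g where g: "adc_morphism K L g"
      and g_nu: "nu_map K g = (\<lambda>i. compose (cells (nu K) i) (G i) (nu_map K p i))"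
      using full[OF inf_functor_compose[OF p.inf_functor_nu_map G]] by blast
    have gG: "nu_map K g i x = G i (nu_map K p i x)" if "x \<in> nu_cells K i" for i x
      using that by (simp add: g_nu nu_def compose_eq)
    obtain f where f: "adc_morphism P L f" "adc_compose K f p = g"
      using adc_morphism_descend[OF p g surj surj_pos fibres[OF G g gG]] by metis
    have "nu_map P f i X = G i X" if "X \<in> nu_cells P i" for i X
    proof -
      obtain x where x: "x \<in> nu_cells K i" "X = nu_map K p i x" using \<open>X \<in> nu_cells P i\<close> surj_cells by blast
      then show ?thesis
        using compose[OF f(1), of i] gG[OF x(1)] by (simp add: f(2) compose_eq)
    qed
    moreover have "nu_map P f i \<in> extensional (nu_cells P i)" for i by (simp add: nu_map_def)
    moreover have "G i \<in> extensional (nu_cells P i)" for i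
      using G.map_cells[of i] by (simp add: nu_def PiE_def)
    ultimately have "nu_map P f = G"
      by (intro ext) (metis extensionalityI)
    then show "G \<in> nu_map P ` adc_hom P L" using f(1) by (auto simp: adc_hom_def)
  qed
  ultimately show ?thesis by (simp add: nu_fully_faithful_def bij_betw_def)
qed

section \<open>Truncations\<close>

definition trunc_proj :: "nat \<Rightarrow> 'a adc_data \<Rightarrow> nat \<Rightarrow> 'a \<Rightarrow> 'a set" where
  "trunc_proj n K i = (\<lambda>x\<in>carrier (chain K i). trunc_sub K n i #>\<^bsub>chain K i\<^esub> x)"

context adc
begin

lemma trunc_proj_surj: "carrier (chain (trunc n K) i) = trunc_proj n K i ` carrier (chain K i)"
  by (simp add: trunc_def trunc_proj_def carrier_FactGroup)

lemma trunc_proj_pos: "pos (trunc n K) i = trunc_proj n K i ` pos K i"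
  by (simp add: trunc_def trunc_proj_def pos_closed)

lemma trunc_proj_morphism: "adc_morphism K (trunc n K) (trunc_proj n K)"
proof -
  interpret trunc: adc "trunc n K" by (rule adc_trunc)
  show ?thesis
  proof unfold_locales
    show "trunc_proj n K i \<in> extensional (carrier (chain K i))" for i by (simp add: trunc_proj_def)
    show "trunc_proj n K i \<in> hom (chain K i) (chain (trunc n K) i)" for i
    proof -
      interpret comm_group "chain K i" by (rule comm_group_chain)
      interpret N: normal "trunc_sub K n i" "chain K i"
        by (rule subgroup_imp_normal[OF subgroup_trunc_sub])
      have "(\<lambda>x. trunc_sub K n i #>\<^bsub>chain K i\<^esub> x) \<in> hom (chain K i) (chain K i Mod trunc_sub K n i)"
        by (rule N.r_coset_hom_Mod)
      then show ?thesis by (auto simp: hom_def trunc_proj_def trunc_def)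
    qed
    show "trunc_proj n K i (diff K (Suc i) x) = diff (trunc n K) (Suc i) (trunc_proj n K (Suc i) x)"
      if "x \<in> carrier (chain K (Suc i))" for i x
      using that diff_trunc[OF that] by (simp add: trunc_proj_def diff_closed)
    show "trunc_proj n K i ` pos K i \<subseteq> pos (trunc n K) i" for i by (simp add: trunc_proj_pos)
    show "aug (trunc n K) (trunc_proj n K 0 x) = aug K x" if "x \<in> carrier (chain K 0)" for x
      using that aug_trunc[OF that] by (simp add: trunc_proj_def)
  qed
qed

lemma trunc_proj_inj:
  assumes "i < n" "x \<in> carrier (chain K i)" "y \<in> carrier (chain K i)"
    "trunc_proj n K i x = trunc_proj n K i y"
  shows "x = y"
proof -
  interpret comm_group "chain K i" by (rule comm_group_chain)
  show ?thesis using assms by (simp add: trunc_proj_def trunc_sub_def r_coset_def)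
qed

text \<open>Above \<open>n\<close> the truncation is the quotient of a group by itself.\<close>

lemma trunc_carrier_above:
  assumes "n < i" "X \<in> carrier (chain (trunc n K) i)"
  shows "X = \<one>\<^bsub>chain (trunc n K) i\<^esub>"
proof -
  interpret comm_group "chain K i" by (rule comm_group_chain)
  obtain x where x: "x \<in> carrier (chain K i)" "X = carrier (chain K i) #>\<^bsub>chain K i\<^esub> x"
    using assms by (auto simp: trunc_proj_surj trunc_proj_def trunc_sub_def)
  then show ?thesis
    using assms(1) coset_join2[OF x(1) subgroup_self x(1)] by (simp add: trunc_def trunc_sub_def)
qed

text \<open>
  Up to dimension \<open>n\<close> a cell is lifted entry by entry. The equation for \<open>d\<close> takes place in degrees below \<open>n\<close>,
  where the projection is injective, so it holds for any choice of lifts; only the two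
  highest entries have to be lifted to the same chain. Cells of higher dimension are iterated
  identities.
\<close>

lemma trunc_proj_nu_surj: "nu_cells (trunc n K) i \<subseteq> nu_map K (trunc_proj n K) i ` nu_cells K i"
proof -
  let ?p = "trunc_proj n K"
  interpret p: adc_morphism K "trunc n K" ?p by (rule trunc_proj_morphism)
  have low: "x \<in> nu_map K ?p i ` nu_cells K i" if i: "i \<le> n" and x: "x \<in> nu_cells (trunc n K) i" for i x
  proof -
    note xD = p.target.nu_cellD[OF x]
    have "\<exists>u. u \<in> pos K k \<and> ?p k u = entry x \<epsilon> k" if "k \<le> i" for k \<epsilon>
      using xD(2)[OF that, of \<epsilon>] by (auto simp: trunc_proj_pos)
    then obtain v where v: "\<And>k \<epsilon>. k \<le> i \<Longrightarrow> v k \<epsilon> \<in> pos K k \<and> ?p k (v k \<epsilon>) = entry x \<epsilon> k" by metis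
    (* The lifts of the two equal highest entries may differ by a boundary: use one of them twice. *)
    define u where "u \<epsilon> k = (if k = i then v k True else v k \<epsilon>)" for \<epsilon> k
    have u: "u \<epsilon> k \<in> pos K k" "?p k (u \<epsilon> k) = entry x \<epsilon> k" if "k \<le> i" for \<epsilon> k
      using v[OF that] p.target.nu_cell_top[OF x, of \<epsilon>] by (auto simp: u_def)
    have uc: "u \<epsilon> k \<in> carrier (chain K k)" if "k \<le> i" for \<epsilon> k using u(1)[OF that] by (rule pos_closed)
    have cell: "to_matrix i u \<in> nu_cells K i"
    proof (rule to_matrix_cell)
      fix \<epsilon> k assume k: "k < i"
      interpret comm_group "chain K k" by (rule comm_group_chain)
      show "diff K (Suc k) (u \<epsilon> (Suc k)) = u True k \<otimes>\<^bsub>chain K k\<^esub> inv\<^bsub>chain K k\<^esub> u False k"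
      proof (rule trunc_proj_inj)
        show "k < n" using k i by simp
        show "?p k (diff K (Suc k) (u \<epsilon> (Suc k))) = ?p k (u True k \<otimes>\<^bsub>chain K k\<^esub> inv\<^bsub>chain K k\<^esub> u False k)"
          using k uc u(2) xD(4)[OF k] by (simp add: p.map_diff p.map_minus)
      qed (use k uc in \<open>simp_all add: diff_closed\<close>)
    next
      show "aug K (u \<epsilon> 0) = 1" for \<epsilon> using p.map_aug[of "u \<epsilon> 0"] uc[of 0] u(2)[of 0] xD(5) by simp
    next
      show "u \<epsilon> k \<in> pos K k" if "k \<le> i" for \<epsilon> k using that by (rule u(1))
    qed (simp add: u_def)
    have "nu_map K ?p i (to_matrix i u) = x"
      by (rule matrix_eqI) (auto simp: p.nu_map_eq[OF cell] xD(1) u(2))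
    then show ?thesis using cell by blast
  qed
  have "nu_cells (trunc n K) (n + r) \<subseteq> nu_map K ?p (n + r) ` nu_cells K (n + r)" for r
  proof (induction r)
    case 0
    then show ?case using low by auto
  next
    case (Suc r)
    show ?case
    proof
      fix x assume "x \<in> nu_cells (trunc n K) (n + Suc r)"
      then have x: "x \<in> nu_cells (trunc n K) (Suc (n + r))" by simp
      have "entry x True (Suc (n + r)) = \<one>\<^bsub>chain (trunc n K) (Suc (n + r))\<^esub>"
        by (rule trunc_carrier_above) (auto intro: p.target.nu_cellD(3)[OF x])
      note x_eq = p.target.cell_with_trivial_top[OF x this]
      then obtain y where y: "y \<in> nu_cells K (n + r)"
        "nu_bound True (n + r) x = nu_map K ?p (n + r) y" using Suc by blast
      interpret F: inf_functor "nu K" "nu (trunc n K)" "nu_map K ?p" by (rule p.inf_functor_nu_map)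
      have "x = nu_map K ?p (Suc (n + r)) (nu_ident K (n + r) y)"
        using x_eq(1) F.map_ident[of y "n + r"] y by (simp add: nu_def)
      then show "x \<in> nu_map K ?p (n + Suc r) ` nu_cells K (n + Suc r)"
        using nu_ident_cell[OF y(1)] by simp
    qed
  qed
  from this[of "i - n"] low show ?thesis by (cases "i \<le> n") auto
qed

end

text \<open>
  It suffices to evaluate \<open>g\<close> on basis elements, that is, to find the highest entry of \<open>G (nu p \<langle>b\<rangle>)\<close>.
  As \<open>nu p \<langle>b\<rangle>\<close> has dimension above \<open>n\<close>, its own highest entry vanishes.
\<close>

lemma (in steiner_adc) trivial_above_truncation:
  assumes G: "inf_functor (nu (trunc n K)) (nu L) G" and g: "adc_morphism K L g"
    and gG: "\<And>i x. x \<in> nu_cells K i \<Longrightarrow> nu_map K g i x = G i (nu_map K (trunc_proj n K) i x)"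
    and i: "n < i" and x: "x \<in> carrier (chain K i)"
  shows "g i x = \<one>\<^bsub>chain L i\<^esub>"
proof -
  interpret g: adc_morphism K L g by (rule g)
  interpret p: adc_morphism K "trunc n K" "trunc_proj n K" by (rule trunc_proj_morphism)
  interpret Li: comm_group "chain L i" by (rule g.target.comm_group_chain)
  have one: "(\<lambda>_. \<one>\<^bsub>chain L i\<^esub>) \<in> hom (chain K i) (chain L i)" by (simp add: hom_def)
  show ?thesis
  proof (rule hom_eqI[OF Li.is_group g.map_hom one _ x])
    fix b assume b: "b \<in> B i"
    obtain j where j: "i = Suc j" using i by (cases i) auto
    let ?A = "to_matrix i (atom K B i b)"
    note A = atom_nu_cell[OF b]
    note pA = p.nu_map_cell[OF A]
    have "entry (nu_map K (trunc_proj n K) i ?A) True i = \<one>\<^bsub>chain (trunc n K) i\<^esub>"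
      using p.target.nu_cellD(3)[OF pA] by (intro trunc_carrier_above[OF i]) simp
    then have "entry (G i (nu_map K (trunc_proj n K) i ?A)) True i = \<one>\<^bsub>chain L i\<^esub>"
      using functor_trivial_top[OF p.target.adc_axioms g.target.adc_axioms G] pA unfolding j by blast
    then show "g i b = \<one>\<^bsub>chain L i\<^esub>"
      using g.nu_map_eq(2)[OF A order_refl, of True] gG[OF A] by simp
  qed
qed

text \<open>
  Cosets of \<open>trunc_sub K n i\<close> are the fibres of the projection, so it has to be shown that \<open>g\<close>
  vanishes on this subgroup. In degree \<open>n\<close> this is \<open>g (d z) = d (g z)\<close> together with the vanishing
  of \<open>g\<close> in degree \<open>n + 1\<close>.
\<close>

theorem nu_fully_faithful_truncation:
  assumes K: "strong_steiner K" and L: "adc L"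
  shows "nu_fully_faithful (trunc n K) L"
proof -
  obtain B where B: "adc K" "adc_basis K B" "unital K B" "strongly_loop_free K B"
    using K by (auto simp: strong_steiner_def)
  interpret steiner_adc K B
    by (intro steiner_adc.intro based_adc.intro steiner_adc_axioms.intro based_adc_axioms.intro B)
  let ?p = "trunc_proj n K"
  show ?thesis
  proof (rule nu_fully_faithful_quotient[OF trunc_proj_morphism L])
    show "nu_fully_faithful K L" using K L by (rule nu_fully_faithful_strong_steiner)
    fix G g i x y
    assume G: "inf_functor (nu (trunc n K)) (nu L) G" and g: "adc_morphism K L g"
      and gG: "\<And>i x. x \<in> nu_cells K i \<Longrightarrow> nu_map K g i x = G i (nu_map K ?p i x)"
      and x: "x \<in> carrier (chain K i)" and y: "y \<in> carrier (chain K i)" and xy: "?p i x = ?p i y"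
    interpret g: adc_morphism K L g by (rule g)
    interpret Ki: comm_group "chain K i" by (rule comm_group_chain)
    interpret Li: comm_group "chain L i" by (rule g.target.comm_group_chain)
    have above: "g j z = \<one>\<^bsub>chain L j\<^esub>" if "n < j" "z \<in> carrier (chain K j)" for j z
      by (rule trivial_above_truncation[OF G g _ that]) (rule gG)
    have kernel: "g i h = \<one>\<^bsub>chain L i\<^esub>" if h: "h \<in> trunc_sub K n i" for h
    proof -
      consider "i < n" "h = \<one>\<^bsub>chain K i\<^esub>" | z where "i = n" "h = diff K (Suc n) z" "z \<in> carrier (chain K (Suc n))"
        | "n < i" "h \<in> carrier (chain K i)"
        using h by (auto simp: trunc_sub_def split: if_splits)
      then show ?thesis
      proof cases
        case 1
        then show ?thesis by (simp add: g.map_one)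
      next
        case 2
        then show ?thesis using above[of "Suc n" z] by (simp add: g.map_diff g.target.diff_one)
      next
        case 3
        then show ?thesis by (rule above)
      qed
    qed
    have "x \<in> trunc_sub K n i #>\<^bsub>chain K i\<^esub> y"
      using xy x y Ki.rcos_self[OF x subgroup_trunc_sub, of n] by (simp add: trunc_proj_def)
    then obtain h where h: "h \<in> trunc_sub K n i" "x = h \<otimes>\<^bsub>chain K i\<^esub> y" by (auto simp: r_coset_def)
    then have "h \<in> carrier (chain K i)" using subgroup.mem_carrier[OF subgroup_trunc_sub] by blast
    then show "g i x = g i y"
      using h y g.map_mult[of h i y] kernel[OF h(1)] g.map_carrier[OF y] by simp
  qed (simp_all add: trunc_proj_surj trunc_proj_pos trunc_proj_nu_surj)
qed

theorem proposition4p5: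
  fixes K :: "'a adc_data" and L :: "'b adc_data" and n m :: nat
  assumes "strong_steiner K" and "strong_steiner L"
  shows "nu_fully_faithful K L
    \<and> nu_fully_faithful K (trunc m L)
    \<and> nu_fully_faithful (trunc n K) L
    \<and> nu_fully_faithful (trunc n K) (trunc m L)"
proof -
  have "adc L" using assms(2) by (simp add: strong_steiner_def)
  then have "adc (trunc m L)" by (rule adc.adc_trunc)
  with \<open>adc L\<close> assms(1) show ?thesis
    by (simp add: nu_fully_faithful_strong_steiner nu_fully_faithful_truncation)
qed

end
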